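(* Let $n\geq 3$ be an integer and let $t_1,t_2,\ldots,t_{n-1}$ be positive real numbers with $t_1>t_2>\cdots>t_{n-2}>t_{n-1}$. Assume: (A) for each $1\leq i\leq n-1$ there is a unique ${\bf z}(i)\in\mathcal F_n^+$ such that $G_{{\bf z}(i)}(t_i)=\min\{G_{\bf x}(t_i):{\bf x}\in\mathcal F_n^+\}$; (B) ${\bf z}(i)\in\mathbb Z^n$ for all $1\leq i\leq n-1$; (C) ${\bf z}(i)\neq{\bf z}(i+1)$ for all $1\leq i\leq n-2$. Then there exist infinitely many pairs of primes $(p,q)$ such that the rational number $p^{f_n}/q^{f_{n-1}}$ has at least $n-2$ exceptional points.
   Context: $f_n$ denotes the Fibonacci sequence: $f_0=0$, $f_1=1$, $f_n=f_{n-1}+f_{n-2}$ for $n\geq 2$; $\phi=(1+\sqrt5)/2$. For integers $1\leq k<\ell\leq n$, ${\bf y}_n(k,\ell)=(y_1,\ldots,y_n)^T\in\mathbb R^n$ has $y_k=(-1)^{\ell-k+1}f_{n-\ell}/f_{\ell-k}$, $y_\ell=f_{n-k}/f_{\ell-k}$, and $y_i=0$ for $i\notin\{k,\ell\}$. Let $\mathcal F_n^+=\{{\bf y}_n(k,\ell):1\leq k<\ell\leq n,\ \ell-k \text{ odd}\}$. For ${\bf x}=(x_1,\ldots,x_n)^T\in\mathbb R^n$ define $G_{\bf x}:(0,\infty)\to\mathbb R$ by $G_{\bf x}(t)=\sum_{i=1}^n x_i\max\{f_i,\phi f_{i-1}\}^t$. For a nonzero algebraic number $\alpha$ with minimal polynomial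 $a\prod_{i=1}^d(z-\alpha_i)$ over $\mathbb Z$, the Mahler measure is $m(\alpha)=\log|a|+\sum_{i=1}^d\log\max\{1,|\alpha_i|\}$. Let $\mathcal P(\alpha)$ be the set of all finite tuples $(\alpha_1,\ldots,\alpha_N)$ of nonzero algebraic numbers ($N\in\mathbb N$) with $\alpha=\prod_i\alpha_i$. For $t>0$, $m_t(\alpha)=\inf\{(\sum_{i=1}^N m(\alpha_i)^t)^{1/t}:(\alpha_1,\ldots,\alpha_N)\in\mathcal P(\alpha)\}$. A real number $t>0$ is an exceptional point for $\alpha$ if for every neighborhood $U$ of $t$ and every $(\alpha_1,\ldots,\alpha_N)\in\mathcal P(\alpha)$ there exists $s\in U$ with $m_s(\alpha)<(\sum_{i=1}^N m(\alpha_i)^s)^{1/s}$. *)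

theory Defs
  imports
    "HOL-Analysis.Analysis"
    "HOL-Computational_Algebra.Computational_Algebra"
    "HOL-Number_Theory.Fib"
begin

definition golden_ratio :: real where
  "golden_ratio = (1 + sqrt 5) / 2"

text \<open>
  A vector of \<open>\<real>\<^sup>n\<close> is represented by a function \<open>nat \<Rightarrow> real\<close> that carries the coordinates
  at the indices \<open>1, \<dots>, n\<close> and vanishes elsewhere, so that equality of functions is
  equality of vectors.
\<close>

definition yvec :: "nat \<Rightarrow> nat \<Rightarrow> nat \<Rightarrow> (nat \<Rightarrow> real)" where
  "yvec n k l = (\<lambda>i.
     if i = k then (- 1) ^ (l - k + 1) * real (fib (n - l)) / real (fib (l - k))
     else if i = l then real (fib (n - k)) / real (fib (l - k))
     else 0)"

definition Fplus :: "nat \<Rightarrow> (nat \<Rightarrow> real) set" where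
  "Fplus n = {yvec n k l |k l. 1 \<le> k \<and> k < l \<and> l \<le> n \<and> odd (l - k)}"

definition Gfun :: "nat \<Rightarrow> (nat \<Rightarrow> real) \<Rightarrow> real \<Rightarrow> real" where
  "Gfun n x t =
     (\<Sum>i=1..n. x i * max (real (fib i)) (golden_ratio * real (fib (i - 1))) powr t)"

text \<open>
  Irreducibility in \<open>\<int>[z]\<close> includes primitivity. The sign of the leading coefficient is
  a normalisation that the Mahler measure does not see.
\<close>

definition is_min_int_poly :: "complex \<Rightarrow> int poly \<Rightarrow> bool" where
  "is_min_int_poly \<alpha> p \<longleftrightarrow>
     irreducible p \<and> lead_coeff p > 0 \<and> poly (map_poly of_int p) \<alpha> = 0"

definition min_int_poly :: "complex \<Rightarrow> int poly" where
  "min_int_poly \<alpha> = (THE p. is_min_int_poly \<alpha> p)"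

lemma ex1_min_int_poly:
  assumes "algebraic \<alpha>"
  shows "\<exists>!p. is_min_int_poly \<alpha> p"
proof -
  define ev where "ev = (\<lambda>p :: int poly. poly (map_poly of_int p) \<alpha>)"
  have ev_altdef: "ev p = (\<Sum>i\<le>n. of_int (coeff p i) * \<alpha> ^ i)" if "degree p \<le> n" for p n
  proof -
    have "ev p = (\<Sum>i\<le>degree p. of_int (coeff p i) * \<alpha> ^ i)"
      by (simp add: ev_def poly_altdef coeff_map_poly degree_map_poly)
    also have "\<dots> = (\<Sum>i\<le>n. of_int (coeff p i) * \<alpha> ^ i)"
      using that by (intro sum.mono_neutral_left) (auto simp: coeff_eq_0)
    finally show ?thesis .
  qed
  have ev_0: "ev 0 = 0"
    by (simp add: ev_def)
  have ev_add: "ev (p + q) = ev p + ev q" for p q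
  proof -
    define n where "n = max (degree p) (degree q)"
    have "degree (p + q) \<le> n" "degree p \<le> n" "degree q \<le> n"
      by (auto simp: n_def degree_add_le)
    then show ?thesis
      by (simp add: ev_altdef[of _ n] algebra_simps sum.distrib)
  qed
  have ev_pCons: "ev (pCons c p) = of_int c + \<alpha> * ev p" for c p
    by (simp add: ev_def map_poly_pCons)
  have ev_smult: "ev (smult c p) = of_int c * ev p" for c p
    by (induction p) (simp_all add: ev_pCons ev_0 algebra_simps)
  have ev_mult: "ev (p * q) = ev p * ev q" for p q
    by (induction p) (simp_all add: ev_pCons ev_0 ev_add ev_smult algebra_simps)
  have ev_unit: "ev u \<noteq> 0" if "is_unit u" for u
  proof
    assume "ev u = 0"
    from that obtain v where "1 = u * v" by auto
    with ev_mult[of u v] \<open>ev u = 0\<close> have "ev 1 = 0" by simp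
    then show False by (simp add: ev_def)
  qed
  have irr_deg: "degree p > 0" if p: "irreducible p" "ev p = 0" for p
  proof (rule ccontr)
    assume "\<not> degree p > 0"
    then obtain c where c: "p = [:c:]" by (metis degree_eq_zeroE gr0I)
    then have "c = 0" using p(2) by (simp add: ev_pCons ev_0)
    with c p(1) show False by simp
  qed
  define N where "N = (\<lambda>p. p \<noteq> 0 \<and> ev p = 0)"
  obtain p0 where p0: "N p0"
    using algebraicE'[OF assms] unfolding N_def ev_def by metis
  have "\<exists>r. N r \<and> (\<forall>q. N q \<longrightarrow> degree r \<le> degree q)"
    using ex_has_least_nat[of N p0 degree] p0 by auto
  then obtain r where r: "N r" and rmin: "\<And>q. N q \<Longrightarrow> degree r \<le> degree q"
    by auto
  have r_deg: "degree r > 0"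
  proof (rule ccontr)
    assume "\<not> degree r > 0"
    then obtain c where "r = [:c:]" by (metis degree_eq_zeroE gr0I)
    with r show False by (simp add: N_def ev_pCons ev_0)
  qed
  have rdvd: "\<exists>c. c \<noteq> 0 \<and> r = smult c p" if p: "irreducible p" "ev p = 0" for p
  proof -
    have prime: "prime_elem p"
      using p(1) by (rule irreducible_imp_prime_elem)
    from pseudo_mod(1)[of r p] r obtain a q where a: "a \<noteq> 0"
      and eq: "smult a p = r * q + pseudo_mod p r" by (auto simp: N_def dest: pseudo_mod(1))
    have "ev (pseudo_mod p r) = 0"
      using arg_cong[OF eq, of ev] p(2) r by (simp add: ev_smult ev_add ev_mult N_def)
    moreover have "pseudo_mod p r = 0 \<or> degree (pseudo_mod p r) < degree r"
      using pseudo_mod(2)[of r p] r by (simp add: N_def)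
    ultimately have "pseudo_mod p r = 0"
      using rmin[of "pseudo_mod p r"] unfolding N_def by linarith
    with eq have eq: "smult a p = r * q" by simp
    then have "p dvd r * q" by (metis dvd_refl dvd_smult)
    then have "p dvd r \<or> p dvd q" using prime by (simp add: prime_elem_dvd_mult_iff)
    moreover have "\<not> p dvd q"
    proof
      assume "p dvd q"
      then obtain u where u: "q = p * u" ..
      have "p * [:a:] = p * (r * u)" using eq u by (simp add: algebra_simps)
      then have "[:a:] = r * u" using p(1) by (metis mult_cancel_left not_irreducible_zero)
      moreover from this a have "u \<noteq> 0" by auto
      ultimately have "degree [:a:] = degree r + degree u"
        using r \<open>[:a:] = r * u\<close> unfolding N_def by (metis degree_mult_eq)
      then show False using r_deg by simp
    qed
    ultimately obtain u where u: "r = p * u" by auto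
    have "u \<noteq> 0" "p \<noteq> 0" using u r by (auto simp: N_def)
    then have "degree r = degree p + degree u" by (simp add: u degree_mult_eq)
    moreover have "degree r \<le> degree p" using rmin[of p] p \<open>p \<noteq> 0\<close> by (simp add: N_def)
    ultimately obtain c where "u = [:c:]" by (metis add_le_same_cancel1 degree_eq_zeroE le_zero_eq)
    with u \<open>u \<noteq> 0\<close> show ?thesis by auto
  qed
  have half: "p dvd q" if pq: "irreducible p" "ev p = 0" "irreducible q" "ev q = 0" for p q
  proof -
    obtain c where c: "c \<noteq> 0" "r = smult c p" using rdvd pq by blast
    obtain d where d: "d \<noteq> 0" "r = smult d q" using rdvd pq by blast
    have "p dvd [:d:] * q" using c d by simp (metis dvd_refl dvd_smult)
    then have "p dvd [:d:] \<or> p dvd q"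
      using irreducible_imp_prime_elem[OF pq(1)] by (blast dest: prime_elem_dvd_multD)
    moreover have "\<not> p dvd [:d:]"
      using irr_deg[OF pq(1,2)] d(1) dvd_imp_degree_le[of p "[:d:]"] by auto
    ultimately show ?thesis by blast
  qed
  have "\<exists>p. irreducible p \<and> ev p = 0"
  proof -
    have "q \<noteq> 0 \<Longrightarrow> ev q = 0 \<Longrightarrow> \<exists>p. irreducible p \<and> ev p = 0" for q
    proof (induction q rule: prime_divisors_induct)
      case zero
      then show ?case by simp
    next
      case (unit u)
      then show ?case using ev_unit by blast
    next
      case (factor p x)
      then show ?case
        by (auto simp: ev_mult intro: prime_elem_imp_irreducible prime_imp_prime_elem)
    qed
    with r show ?thesis by (auto simp: N_def)
  qed
  then obtain p where p: "irreducible p" "ev p = 0" by blast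
  define p' where "p' = (if lead_coeff p > 0 then p else - p)"
  have "ev (- p) = 0" using ev_smult[of "-1" p] p(2) by simp
  moreover have "irreducible (- p)"
    using p(1) irreducible_mult_unit_left[of "- 1" p] by simp
  ultimately have "is_min_int_poly \<alpha> p'"
    using p irr_deg[OF p] by (auto simp: is_min_int_poly_def p'_def ev_def not_less
        order_le_less)
  moreover have "p1 = p2" if "is_min_int_poly \<alpha> p1" "is_min_int_poly \<alpha> p2" for p1 p2
  proof -
    have pq: "irreducible p1" "ev p1 = 0" "irreducible p2" "ev p2 = 0"
      using that by (auto simp: is_min_int_poly_def ev_def)
    have "normalize p1 = normalize p2"
      using half pq by (intro associatedI) auto
    moreover have "normalize p = p" if "lead_coeff p > 0" for p :: "int poly"
      using that by (simp add: normalize_poly_def sgn_if flip: one_pCons)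
    ultimately show ?thesis using that by (simp add: is_min_int_poly_def)
  qed
  ultimately show ?thesis by blast
qed

definition log_mahler :: "complex \<Rightarrow> real" where
  "log_mahler \<alpha> =
     ln \<bar>real_of_int (lead_coeff (min_int_poly \<alpha>))\<bar> +
     (\<Sum>\<beta>\<in>#proots (map_poly of_int (min_int_poly \<alpha>) :: complex poly). ln (max 1 (cmod \<beta>)))"

definition factorizations :: "complex \<Rightarrow> complex list set" where
  "factorizations \<alpha> =
     {xs. xs \<noteq> [] \<and> (\<forall>x\<in>set xs. algebraic x \<and> x \<noteq> 0) \<and> prod_list xs = \<alpha>}"

definition tuple_measure :: "real \<Rightarrow> complex list \<Rightarrow> real" where
  "tuple_measure t xs = (\<Sum>x\<leftarrow>xs. log_mahler x powr t) powr (1 / t)"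

definition metric_mahler :: "real \<Rightarrow> complex \<Rightarrow> real" where
  "metric_mahler t \<alpha> = (INF xs\<in>factorizations \<alpha>. tuple_measure t xs)"

text \<open>
  The measures \<open>metric_mahler s\<close> are only meaningful for \<open>s > 0\<close>, so neighbourhoods are
  taken in \<open>(0, \<infinity>)\<close>.
\<close>

definition exceptional_point :: "complex \<Rightarrow> real \<Rightarrow> bool" where
  "exceptional_point \<alpha> t \<longleftrightarrow> t > 0 \<and>
     (\<forall>U. U \<subseteq> {0<..} \<and> t \<in> interior U \<longrightarrow>
        (\<forall>xs\<in>factorizations \<alpha>. \<exists>s\<in>U. metric_mahler s \<alpha> < tuple_measure s xs))"

end

(*
  Put theta = log q / log p. If p^(f_n) / q^(f_(n-1)) is a product of algebraic numbers, the leading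
  and constant coefficients of their minimal polynomials yield pairs (u_i, w_i) of naturals summing
  to (f_n, f_(n-1)) such that the i-th Mahler measure is at least log p * max(u_i, theta * w_i).
  When theta is close to phi, each (u, w) splits into Fibonacci pairs (f_j, f_(j-1)) with j of a
  fixed parity, so that for s >= 1 the sum of s-th powers does not increase; for s <= 1 the trivial
  factorization is optimal. What remains is a linear program over the Fibonacci pairs, whose
  vertices form F_n^+. Hence near t_i the measure m_s is attained by the factorization that belongs
  to the integer vector z(i), for every theta near phi; such theta come from primes in intervals
  (x, x^(1+eps)].

  Were there no exceptional point between t_(i+1) and t_i, then m_s^s would be given by one and the
  same sum of exponentials on the whole interval, contradicting the uniqueness of the minimum at t_i.
*)

theory Submission
  imports
    Defs
    "HOL-Complex_Analysis.Complex_Analysis"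
    "HOL-Real_Asymp.Real_Asymp"
    "Jordan_Normal_Form.Char_Poly"
begin

section \<open>Sums of Fibonacci pairs\<close>

text \<open>The quotients \<open>fib j / fib (j - 1)\<close> alternate around
  \<open>golden_ratio\<close>. Hence for \<theta> near it the parity of \<open>j\<close> decides
  which entry of \<open>max (fib j) (\<theta> * fib (j - 1))\<close> is the larger one, and on sums
  of pairs of one parity the maximum is additive. Only the indices \<open>j \<le> n\<close> matter,
  so closeness to \<open>golden_ratio\<close> is an open condition on \<theta>, and a crude result
  on primes suffices: intervals (x, x^(1+eps)] can be treated through the size of lcm(1, ..., N).
  The factors of the quotient may be irrational, so exponents of p and q are not at hand for the
  single factors; the substitute is that the leading coefficient times a root is an algebraic
  integer. Integrality of z(i) turns a vertex of the linear program into an actual factorization,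
  and uniqueness of the minimum gives strict inequalities, which survive small changes of \<theta>
  and \<open>s\<close> together.\<close>

lemma golden_ratio_sq: "golden_ratio\<^sup>2 = golden_ratio + 1"
  by (simp add: golden_ratio_def power2_eq_square field_simps)

lemma golden_ratio_gt_1: "golden_ratio > 1"
  by (simp add: golden_ratio_def real_less_rsqrt)

text \<open>\<open>1 - golden_ratio\<close> is the conjugate root of x^2 = x + 1, so both sides
  satisfy the Fibonacci recurrence. It is negative, and its alternating powers are the source of
  every parity distinction below.\<close>

lemma fib_minus_golden_ratio_mult:
  "real (fib (Suc j)) - golden_ratio * real (fib j) = (1 - golden_ratio) ^ j"
proof (induction j rule: fib.induct)
  case (3 n)
  have "real (fib (Suc (Suc (Suc n)))) - golden_ratio * real (fib (Suc (Suc n))) =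
      (1 - golden_ratio) ^ Suc n + (1 - golden_ratio) ^ n"
    unfolding "3.IH"[symmetric] by (simp add: algebra_simps)
  also have "\<dots> = (1 - golden_ratio) ^ Suc (Suc n)"
  proof -
    have "(1 - golden_ratio)\<^sup>2 = (1 - golden_ratio) + 1"
      using golden_ratio_sq by (simp add: power2_eq_square algebra_simps)
    then have "(1 - golden_ratio) ^ n * (1 - golden_ratio)\<^sup>2 = (1 - golden_ratio) ^ n * ((1 - golden_ratio) + 1)"
      by simp
    then show ?thesis by (simp add: algebra_simps power2_eq_square)
  qed
  finally show ?case .
qed auto

lemma fib_gt_golden_ratio_mult:
  assumes "odd j"
  shows "golden_ratio * real (fib (j - 1)) < real (fib j)"
proof -
  obtain i where j: "j = Suc i" "even i" using assms by (metis even_Suc odd_pos Suc_pred)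
  have "(1 - golden_ratio) ^ i > 0"
    using j(2) golden_ratio_gt_1 by (simp add: zero_less_power_eq)
  then show ?thesis using fib_minus_golden_ratio_mult[of i] j by simp
qed

lemma fib_less_golden_ratio_mult:
  assumes "even j" "j > 0"
  shows "real (fib j) < golden_ratio * real (fib (j - 1))"
proof -
  obtain i where j: "j = Suc i" "odd i" using assms by (metis even_Suc Suc_pred)
  have "(1 - golden_ratio) ^ i < 0"
    using j(2) golden_ratio_gt_1 by (simp add: power_less_zero_eq)
  then have "real (fib (Suc i)) - golden_ratio * real (fib i) < 0"
    unfolding fib_minus_golden_ratio_mult .
  then show ?thesis using j by simp
qed

text \<open>Both sides satisfy the Fibonacci recurrence in \<open>m\<close>; \<open>m = 1\<close> is
  Cassini's identity. The left side is a determinant of two Fibonacci pairs.\<close>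

lemma fib_dOcagne:
  "int (fib (Suc a)) * int (fib (a + m)) - int (fib a) * int (fib (Suc (a + m))) = (- 1) ^ a * int (fib m)"
proof (induction m rule: fib.induct)
  case 2
  then show ?case using fib_Cassini_int[of a] by (simp add: power2_eq_square algebra_simps)
next
  case (3 m)
  have "int (fib (Suc a)) * int (fib (a + Suc (Suc m))) - int (fib a) * int (fib (Suc (a + Suc (Suc m)))) =
     (- 1) ^ a * int (fib m) + (- 1) ^ a * int (fib (Suc m))"
    unfolding "3.IH"[symmetric] by (simp add: algebra_simps)
  then show ?case by (simp add: algebra_simps)
qed (simp add: algebra_simps)

lemma fib_le_fib_imp_le:
  assumes "fib j \<le> fib n" "n \<ge> 3"
  shows "j \<le> n"
proof (rule ccontr)
  assume "\<not> j \<le> n"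
  then have "fib (Suc n) \<le> fib j" by (intro fib_mono) simp
  moreover have "fib (Suc n) > fib n"
    using assms(2) fib_neq_0_nat[of "n - 1"] by (cases n) auto
  ultimately show False using assms(1) by simp
qed

text \<open>Again a recurrence, in \<open>r\<close>; the case \<open>r = 1\<close> is d'Ocagne's
  identity with the sign of odd \<open>m\<close>. For \<open>m = l - k\<close> and
  \<open>r = n - l\<close> it says that \<open>yvec n k l\<close> satisfies the equations of the
  linear program.\<close>

lemma fib_opposite_parity:
  assumes "odd m"
  shows "fib m * fib (k + m + r) = fib r * fib k + fib (m + r) * fib (k + m)"
proof (induction r rule: fib.induct)
  case 1
  then show ?case by simp
next
  case 2
  have "fib m * fib (Suc (k + m)) = fib k + fib (Suc m) * fib (k + m)"
  proof -
    have "int (fib (Suc m)) * int (fib (m + k)) - int (fib m) * int (fib (Suc (m + k))) = - int (fib k)"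
      using fib_dOcagne[of m k] assms by simp
    then have "int (fib m * fib (Suc (k + m))) = int (fib k + fib (Suc m) * fib (k + m))"
      by (simp add: algebra_simps)
    then show ?thesis by presburger
  qed
  then show ?case by simp
next
  case (3 r)
  then show ?case by (simp add: algebra_simps)
qed

text \<open>
  The pairs \<open>(fib j, fib (j - 1))\<close> with \<open>j\<close> odd generate the monoid of lattice points below the
  line of slope \<open>1 / golden_ratio\<close>: the inverse of the shift \<open>j \<mapsto> j + 2\<close> is
  \<open>(u, w) \<mapsto> (u - w, 2 * w - u)\<close>.
\<close>

lemma odd_fib_decomposition:
  assumes "golden_ratio * real w < real u"
  shows "\<exists>js. (\<forall>j\<in>set js. odd j) \<and> sum_list (map fib js) = u \<and>
           sum_list (map (\<lambda>j. fib (j - 1)) js) = w"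
  using assms
proof (induction w arbitrary: u rule: less_induct)
  case (less w)
  show ?case
  proof (cases "2 * w \<le> u")
    case True
    \<comment> \<open>(u, w) consists of \<open>w\<close> copies of (2, 1) and
      \<open>u - 2 * w\<close> copies of (1, 0), the pairs of index 3 and 1.\<close>
    have "fib 3 = 2" by (simp add: numeral_3_eq_3)
    then have "sum_list (map fib (replicate w 3 @ replicate (u - 2 * w) 1)) = u"
      "sum_list (map (\<lambda>j. fib (j - 1)) (replicate w 3 @ replicate (u - 2 * w) 1)) = w"
      using True by (auto simp: sum_list_replicate)
    then show ?thesis
      by (intro exI[of _ "replicate w 3 @ replicate (u - 2 * w) 1"]) auto
  next
    case False
    have w0: "w > 0" using False by (cases w) auto
    have "real w < golden_ratio * real w"
      using golden_ratio_gt_1 w0 by simp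
    then have uw: "w < u" using less.prems by linarith
    define u' w' where "u' = u - w" and "w' = 2 * w - u"
    have u': "real u' = real u - real w" and w': "real w' = 2 * real w - real u"
      using uw False by (auto simp: u'_def w'_def)
    \<comment> \<open>The linear form \<open>u - golden_ratio * w\<close> is an eigenvector of the
      inverse shift: it is multiplied by the square of \<open>golden_ratio\<close>, so the
      hypothesis passes to (u', w').\<close>
    have "0 < golden_ratio\<^sup>2 * (real u - golden_ratio * real w)"
      using less.prems golden_ratio_gt_1 by simp
    also have "\<dots> = real u' - golden_ratio * real w'"
    proof -
      have g: "golden_ratio * (golden_ratio * x) = golden_ratio * x + x" for x
        using golden_ratio_sq by (simp add: power2_eq_square algebra_simps flip: mult.assoc)
      show ?thesis
        unfolding power2_eq_square u' w' by (simp add: algebra_simps g)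
    qed
    finally have "golden_ratio * real w' < real u'" by simp
    moreover have "w' < w" using uw w0 by (auto simp: w'_def)
    ultimately obtain js where js: "\<forall>j\<in>set js. odd j" "sum_list (map fib js) = u'"
        "sum_list (map (\<lambda>j. fib (j - 1)) js) = w'"
      using less.IH by blast
    define ks where "ks = map (\<lambda>j. j + 2) js"
    have e: "fib (j + 2) = 2 * fib j + fib (j - 1)" "fib (j + 2 - 1) = fib j + fib (j - 1)" if "odd j" for j
      using that by (cases j; simp)+
    have "sum_list (map fib ks) = sum_list (map (\<lambda>j. 2 * fib j + fib (j - 1)) js)"
      unfolding ks_def map_map using js(1) e by (intro arg_cong[of _ _ sum_list] map_cong) auto
    moreover have "sum_list (map (\<lambda>j. fib (j - 1)) ks) = sum_list (map (\<lambda>j. fib j + fib (j - 1)) js)"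
      unfolding ks_def map_map using js(1) e by (intro arg_cong[of _ _ sum_list] map_cong) auto
    ultimately have "sum_list (map fib ks) = 2 * u' + w'" "sum_list (map (\<lambda>j. fib (j - 1)) ks) = u' + w'"
      using js by (simp_all add: sum_list_addf sum_list_const_mult)
    moreover have "2 * u' + w' = u" "u' + w' = w" using uw False by (auto simp: u'_def w'_def)
    moreover have "\<forall>j\<in>set ks. odd j" using js(1) by (auto simp: ks_def)
    ultimately show ?thesis by auto
  qed
qed

text \<open>The map (u, w) \<mapsto> (w, u - w) lowers the index of a Fibonacci pair by one and so
  reduces the even case to the odd one; \<open>w \<le> u\<close> keeps the image in the
  naturals.\<close>

lemma even_fib_decomposition:
  assumes "real u < golden_ratio * real w" "w \<le> u"
  shows "\<exists>js. (\<forall>j\<in>set js. even j \<and> j > 0) \<and> sum_list (map fib js) = u \<and>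
           sum_list (map (\<lambda>j. fib (j - 1)) js) = w"
proof -
  have "(golden_ratio + 1) * real w > golden_ratio * real u"
    unfolding golden_ratio_sq[symmetric] using assms(1) golden_ratio_gt_1 
    by (simp add: power2_eq_square mult.assoc)
  then have "golden_ratio * real (u - w) < real w"
    using assms(2) by (simp add: of_nat_diff algebra_simps)
  then obtain js where js: "\<forall>j\<in>set js. odd j" "sum_list (map fib js) = w"
        "sum_list (map (\<lambda>j. fib (j - 1)) js) = u - w"
    using odd_fib_decomposition by blast
  define ks where "ks = map Suc js"
  have e: "fib (Suc j) = fib j + fib (j - 1)" if "odd j" for j
    using that by (cases j) auto
  have "sum_list (map fib ks) = sum_list (map (\<lambda>j. fib j + fib (j - 1)) js)"
    unfolding ks_def map_map using js(1) e by (intro arg_cong[of _ _ sum_list] map_cong) auto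
  then have "sum_list (map fib ks) = u" using js assms by (simp add: sum_list_addf)
  moreover have "sum_list (map (\<lambda>j. fib (j - 1)) ks) = w"
    using js by (simp add: ks_def o_def)
  moreover have "\<forall>j\<in>set ks. even j \<and> j > 0" using js(1) by (auto simp: ks_def)
  ultimately show ?thesis by blast
qed

text \<open>Otherwise \<open>sqrt 5\<close> would be a rational algebraic integer, hence an integer
  strictly between 2 and 3. So no lattice point with \<open>w > 0\<close> lies on the line that
  separates the two parities.\<close>

lemma golden_ratio_mult_nat_neq:
  assumes "w > 0"
  shows "golden_ratio * real w \<noteq> real u"
proof
  assume "golden_ratio * real w = real u"
  then have g: "golden_ratio = real u / real w" using assms by (simp add: field_simps)
  then have "sqrt 5 = 2 * (real u / real w) - 1" by (simp add: golden_ratio_def field_simps)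
  then have "sqrt 5 \<in> \<rat>" by simp
  moreover have "algebraic_int (sqrt (5::real))"
    by (intro algebraic_int_sqrt int_imp_algebraic_int) auto
  ultimately have "sqrt 5 \<in> \<int>" by (intro rational_algebraic_int_is_int)
  then obtain k where k: "sqrt 5 = of_int k" by (elim Ints_cases)
  have "2 < sqrt 5" "sqrt 5 < 3" by (simp_all add: real_less_rsqrt real_less_lsqrt)
  then have "2 < k" "k < 3" unfolding k by simp_all
  then show False by simp
qed

text \<open>Each x is at most the sum S, so x * x^(s-1) is compared with x * S^(s-1). For
  \<open>s \<le> 1\<close> the exponent s - 1 is not positive and the comparison reverses, which
  gives the subadditive counterpart.\<close>

lemma powr_sum_list_superadditive:
  fixes xs :: "real list"
  assumes "\<forall>x\<in>set xs. 0 \<le> x" "s \<ge> 1"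
  shows "(\<Sum>x\<leftarrow>xs. x powr s) \<le> (sum_list xs) powr s"
proof -
  have "x powr s \<le> x * (sum_list xs) powr (s - 1)" if x: "x \<in> set xs" for x
  proof (cases "x = 0")
    case False
    have "x \<le> sum_list xs" using assms(1) x by (simp add: member_le_sum_list)
    then have "x * x powr (s - 1) \<le> x * (sum_list xs) powr (s - 1)"
      using assms x by (intro mult_left_mono powr_mono2) auto
    moreover have "x * x powr (s - 1) = x powr s"
      using False assms(1) x by (simp add: powr_mult_base)
    ultimately show ?thesis by simp
  qed simp
  then have "(\<Sum>x\<leftarrow>xs. x powr s) \<le> (\<Sum>x\<leftarrow>xs. x * (sum_list xs) powr (s - 1))"
    by (intro sum_list_mono) auto
  also have "\<dots> = sum_list xs * (sum_list xs) powr (s - 1)"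
    by (simp add: sum_list_mult_const)
  also have "\<dots> = (sum_list xs) powr s"
    using assms by (simp add: powr_mult_base sum_list_nonneg)
  finally show ?thesis .
qed

lemma powr_sum_list_subadditive:
  fixes xs :: "real list"
  assumes "\<forall>x\<in>set xs. 0 \<le> x" "s \<le> 1"
  shows "(sum_list xs) powr s \<le> (\<Sum>x\<leftarrow>xs. x powr s)"
proof -
  have "x * (sum_list xs) powr (s - 1) \<le> x powr s" if x: "x \<in> set xs" for x
  proof (cases "x = 0")
    case False
    have "x \<le> sum_list xs" using assms(1) x by (simp add: member_le_sum_list)
    then have "x * (sum_list xs) powr (s - 1) \<le> x * x powr (s - 1)"
      using assms x False by (intro mult_left_mono powr_mono2') (auto simp: order_less_le)
    moreover have "x * x powr (s - 1) = x powr s"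
      using False assms(1) x by (simp add: powr_mult_base)
    ultimately show ?thesis by simp
  qed simp
  then have "(\<Sum>x\<leftarrow>xs. x * (sum_list xs) powr (s - 1)) \<le> (\<Sum>x\<leftarrow>xs. x powr s)"
    by (intro sum_list_mono) auto
  moreover have "(\<Sum>x\<leftarrow>xs. x * (sum_list xs) powr (s - 1)) = sum_list xs * (sum_list xs) powr (s - 1)"
    by (simp add: sum_list_mult_const)
  moreover have "\<dots> = (sum_list xs) powr s"
    using assms by (simp add: powr_mult_base sum_list_nonneg)
  ultimately show ?thesis by simp
qed

section \<open>The linear program over the Fibonacci pairs\<close>

lemma sum_yvec:
  assumes "1 \<le> k" "k < l" "l \<le> n" "odd (l - k)"
  shows "(\<Sum>i=1..n. yvec n k l i * c i) =
           (real (fib (n - l)) * c k + real (fib (n - k)) * c l) / real (fib (l - k))"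
proof -
  have "(\<Sum>i=1..n. yvec n k l i * c i) = (\<Sum>i\<in>{k, l}. yvec n k l i * c i)"
    using assms by (intro sum.mono_neutral_right) (auto simp: yvec_def)
  also have "\<dots> = yvec n k l k * c k + yvec n k l l * c l"
    using assms by simp
  also have "\<dots> = (real (fib (n - l)) * c k + real (fib (n - k)) * c l) / real (fib (l - k))"
    using assms by (simp add: yvec_def add_divide_distrib)
  finally show ?thesis .
qed

text \<open>Since \<open>fib 0 = 0\<close> and \<open>fib 1 = 1\<close>, this vertex is the n-th
  unit vector. It belongs to the trivial factorization with a single factor.\<close>

lemma yvec_last_in_Fplus:
  assumes "n \<ge> 2"
  shows "yvec n (n - 1) n \<in> Fplus n" "(\<Sum>i=1..n. yvec n (n - 1) n i * c i) = c n"
proof -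
  show "yvec n (n - 1) n \<in> Fplus n"
    using assms unfolding Fplus_def by (intro CollectI exI[of _ "n - 1"] exI[of _ n]) auto
  show "(\<Sum>i=1..n. yvec n (n - 1) n i * c i) = c n"
    using assms by (subst sum_yvec) auto
qed

text \<open>The determinant of the j-th pair against the n-th one has a sign given by the parity of
  \<open>j\<close> and vanishes for \<open>j = n\<close>. Eliminating between the two equations of
  the linear program therefore balances even against odd indices.\<close>

lemma fib_dOcagne_last:
  assumes "1 \<le> j" "j \<le> n"
  shows "real (fib j) * real (fib (n - 1)) - real (fib (j - 1)) * real (fib n) =
           (- 1) ^ (j - 1) * real (fib (n - j))"
proof -
  have "int (fib (Suc (j - 1))) * int (fib (j - 1 + (n - j))) -
      int (fib (j - 1)) * int (fib (Suc (j - 1 + (n - j)))) = (- 1) ^ (j - 1) * int (fib (n - j))"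
    by (rule fib_dOcagne)
  moreover have "Suc (j - 1) = j" "j - 1 + (n - j) = n - 1" "Suc (n - 1) = n"
    using assms by auto
  ultimately have "int (fib j) * int (fib (n - 1)) - int (fib (j - 1)) * int (fib n) =
      (- 1) ^ (j - 1) * int (fib (n - j))" by simp
  then have "real_of_int (int (fib j) * int (fib (n - 1)) - int (fib (j - 1)) * int (fib n)) =
      real_of_int ((- 1) ^ (j - 1) * int (fib (n - j)))" by presburger
  then show ?thesis by simp
qed

lemma fib_opposite_parity':
  assumes "1 \<le> k" "k < l" "l \<le> n" "odd (l - k)"
  shows "real (fib (l - k)) * real (fib n) =
           real (fib (n - l)) * real (fib k) + real (fib (n - k)) * real (fib l)"
proof -
  have "fib (l - k) * fib (k + (l - k) + (n - l)) =
      fib (n - l) * fib k + fib (l - k + (n - l)) * fib (k + (l - k))"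
    using assms by (intro fib_opposite_parity) auto
  moreover have "k + (l - k) + (n - l) = n" "l - k + (n - l) = n - k" "k + (l - k) = l"
    using assms by auto
  ultimately have "fib (l - k) * fib n = fib (n - l) * fib k + fib (n - k) * fib l"
    by simp
  then show ?thesis by (metis of_nat_add of_nat_mult)
qed

text \<open>
  The vectors \<open>yvec n k l\<close> are the vertices of the polytope of all \<open>x \<ge> 0\<close> that satisfy the two
  equations below. With \<open>g i = fib n * c i - m * fib i\<close> the bounds at the vertices read
  \<open>fib (n - l) * g k + fib (n - k) * g l \<ge> 0\<close>; one multiplies these by \<open>x k * x l\<close> and sums over
  all \<open>k\<close> and \<open>l\<close> of opposite parity.
\<close>

lemma linear_lower_bound_Fplus:
  fixes c x :: "nat \<Rightarrow> real"
  assumes n: "n \<ge> 2"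
    and m: "\<And>y. y \<in> Fplus n \<Longrightarrow> m \<le> (\<Sum>i=1..n. y i * c i)"
    and x: "\<And>i. x i \<ge> 0"
    and x1: "(\<Sum>i=1..n. x i * real (fib i)) = real (fib n)"
    and x2: "(\<Sum>i=1..n. x i * real (fib (i - 1))) = real (fib (n - 1))"
  shows "m \<le> (\<Sum>i=1..n. x i * c i)"
proof -
  define g where "g = (\<lambda>i. real (fib n) * c i - m * real (fib i))"
  \<comment> \<open>Index \<open>n\<close> stays outside both classes: its weight
    \<open>fib (n - n) = 0\<close> removes it from the pairing, and \<open>g n \<ge> 0\<close>
    handles it separately.\<close>
  define E Q where "E = {i\<in>{1..<n}. even i}" and "Q = {i\<in>{1..<n}. odd i}"
  have fin: "finite E" "finite Q" by (auto simp: E_def Q_def)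
  have split: "(\<Sum>i=1..n. f i) = (\<Sum>i\<in>E. f i) + (\<Sum>i\<in>Q. f i) + f n" for f :: "nat \<Rightarrow> real"
  proof -
    have "{1..n} = insert n (E \<union> Q)" using n by (auto simp: E_def Q_def)
    moreover have "E \<inter> Q = {}" "n \<notin> E \<union> Q" by (auto simp: E_def Q_def)
    ultimately show ?thesis using fin by (simp add: sum.union_disjoint)
  qed
  have fn: "real (fib n) > 0" using n fib_neq_0_nat[of n] by simp
  have gn: "g n \<ge> 0"
    using m[OF yvec_last_in_Fplus(1)[OF n]] fn unfolding yvec_last_in_Fplus(2)[OF n]
    by (simp add: g_def)
  have pair1: "real (fib (n - l)) * g k + real (fib (n - k)) * g l \<ge> 0"
    if kl: "1 \<le> k" "k < l" "l \<le> n" "odd (l - k)" for k l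
  proof -
    have flk: "real (fib (l - k)) > 0" using kl fib_neq_0_nat[of "l - k"] by simp
    have "yvec n k l \<in> Fplus n" unfolding Fplus_def using kl by blast
    from m[OF this] have "m * real (fib (l - k)) \<le> real (fib (n - l)) * c k + real (fib (n - k)) * c l"
      unfolding sum_yvec[OF kl] using flk by (simp add: field_simps)
    then have "m * real (fib (l - k)) * real (fib n) \<le>
        (real (fib (n - l)) * c k + real (fib (n - k)) * c l) * real (fib n)"
      using fn by (intro mult_right_mono) auto
    moreover have "m * real (fib (l - k)) * real (fib n) =
        m * (real (fib (n - l)) * real (fib k) + real (fib (n - k)) * real (fib l))"
      unfolding fib_opposite_parity'[OF kl, symmetric] by simp
    ultimately show ?thesis by (simp add: g_def algebra_simps)
  qed
  have pair: "real (fib (n - l)) * g k + real (fib (n - k)) * g l \<ge> 0" if "k \<in> E" "l \<in> Q" for k l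
  proof (cases "k < l")
    case True
    then show ?thesis using that by (intro pair1) (auto simp: E_def Q_def)
  next
    case False
    have "k \<noteq> l" using that by (auto simp: E_def Q_def)
    then have "real (fib (n - k)) * g l + real (fib (n - l)) * g k \<ge> 0"
      using that False by (intro pair1) (auto simp: E_def Q_def)
    then show ?thesis by simp
  qed
  define S where "S = (\<Sum>k\<in>E. x k * real (fib (n - k)))"
  \<comment> \<open>This is \<open>fib (n - 1)\<close> times the first equation minus
    \<open>fib n\<close> times the second. It shows that both parity classes have the same weighted
    total \<open>S\<close>, so that the double sum further down factors through
    \<open>S\<close>.\<close>
  have "(\<Sum>j=1..n. x j * ((- 1) ^ (j - 1) * real (fib (n - j)))) =
      (\<Sum>j=1..n. x j * (real (fib j) * real (fib (n - 1)) - real (fib (j - 1)) * real (fib n)))"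
    by (intro sum.cong refl) (subst fib_dOcagne_last; simp)
  also have "\<dots> = (\<Sum>j=1..n. x j * real (fib j)) * real (fib (n - 1)) -
                  (\<Sum>j=1..n. x j * real (fib (j - 1))) * real (fib n)"
    unfolding sum_distrib_right sum_subtractf[symmetric]
    by (intro sum.cong refl) (simp only: right_diff_distrib mult.assoc)
  also have "\<dots> = 0" unfolding x1 x2 by simp
  finally have "0 = (\<Sum>j\<in>E. x j * ((- 1) ^ (j - 1) * real (fib (n - j)))) +
      (\<Sum>j\<in>Q. x j * ((- 1) ^ (j - 1) * real (fib (n - j))))"
    unfolding split by simp
  also have "(\<Sum>j\<in>E. x j * ((- 1) ^ (j - 1) * real (fib (n - j)))) = (\<Sum>j\<in>E. - (x j * real (fib (n - j))))"
    by (intro sum.cong) (auto simp: E_def)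
  also have "(\<Sum>j\<in>Q. x j * ((- 1) ^ (j - 1) * real (fib (n - j)))) = (\<Sum>j\<in>Q. x j * real (fib (n - j)))"
    by (intro sum.cong) (auto simp: Q_def)
  finally have SQ: "(\<Sum>l\<in>Q. x l * real (fib (n - l))) = S"
    by (simp add: S_def sum_negf)
  have "0 \<le> (\<Sum>k\<in>E. \<Sum>l\<in>Q. x k * x l * (real (fib (n - l)) * g k + real (fib (n - k)) * g l))"
    using pair x by (intro sum_nonneg mult_nonneg_nonneg) auto
  also have "\<dots> = (\<Sum>k\<in>E. \<Sum>l\<in>Q. (x k * g k) * (x l * real (fib (n - l)))) +
                  (\<Sum>k\<in>E. \<Sum>l\<in>Q. (x k * real (fib (n - k))) * (x l * g l))"
    by (simp add: sum.distrib algebra_simps)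
  also have "\<dots> = (\<Sum>k\<in>E. x k * g k) * S + S * (\<Sum>l\<in>Q. x l * g l)"
    by (simp add: sum_product[symmetric] SQ S_def)
  finally have *: "0 \<le> S * ((\<Sum>k\<in>E. x k * g k) + (\<Sum>l\<in>Q. x l * g l))"
    by (simp add: algebra_simps)
  have "S \<ge> 0" unfolding S_def using x by (intro sum_nonneg) auto
  have "0 \<le> (\<Sum>k\<in>E. x k * g k) + (\<Sum>l\<in>Q. x l * g l)"
  proof (cases "S = 0")
    case False
    with \<open>S \<ge> 0\<close> * show ?thesis by (simp add: zero_le_mult_iff)
  next
    case True
    \<comment> \<open>If \<open>S = 0\<close>, the positive weights \<open>fib (n - k)\<close> force
      \<open>x k = 0\<close> for all \<open>k < n\<close>, and only index \<open>n\<close>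
      remains.\<close>
    have pos: "real (fib (n - k)) > 0" if "k < n" for k
      using that fib_neq_0_nat[of "n - k"] by simp
    have "x k = 0" if "k \<in> E" for k
    proof -
      have "x k * real (fib (n - k)) = 0"
        using True x that fin unfolding S_def by (subst (asm) sum_nonneg_eq_0_iff) auto
      then show ?thesis using pos[of k] that by (auto simp: E_def)
    qed
    moreover have "x k = 0" if "k \<in> Q" for k
    proof -
      have "x k * real (fib (n - k)) = 0"
        using True x that fin unfolding SQ[symmetric] by (subst (asm) sum_nonneg_eq_0_iff) auto
      then show ?thesis using pos[of k] that by (auto simp: Q_def)
    qed
    ultimately show ?thesis by simp
  qed
  with gn x have "0 \<le> (\<Sum>i=1..n. x i * g i)" unfolding split by simp
  also have "\<dots> = real (fib n) * (\<Sum>i=1..n. x i * c i) - m * (\<Sum>i=1..n. x i * real (fib i))"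
    unfolding sum_distrib_left sum_subtractf[symmetric]
    by (intro sum.cong refl) (simp add: g_def algebra_simps)
  finally have "real (fib n) * m \<le> real (fib n) * (\<Sum>i=1..n. x i * c i)"
    unfolding x1 by (simp add: mult.commute)
  then show ?thesis using fn by (simp add: mult_le_cancel_left)
qed

section \<open>From partitions of (fib n, fib (n - 1)) to the linear program\<close>

lemma sum_list_eq_sum_count_list:
  fixes f :: "'a \<Rightarrow> real"
  assumes "set xs \<subseteq> A" "finite A"
  shows "(\<Sum>x\<leftarrow>xs. f x) = (\<Sum>a\<in>A. real (count_list xs a) * f a)"
  using assms(1)
proof (induction xs)
  case (Cons x xs)
  have "(\<Sum>a\<in>A. real (count_list (x # xs) a) * f a) =
      (\<Sum>a\<in>A. real (count_list xs a) * f a + (if a = x then f x else 0))"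
    by (intro sum.cong) (auto simp: algebra_simps)
  then show ?case using Cons assms(2) by (simp add: sum.distrib)
qed simp

text \<open>For primes p < q and \<theta> = log q / log p this is the Mahler measure of p^(f_j) /
  q^(f_(j-1)) divided by log p. At \<open>golden_ratio\<close> it is the base that occurs in
  \<open>Gfun\<close>.\<close>

definition fib_height :: "real \<Rightarrow> nat \<Rightarrow> real" where
  "fib_height \<theta> j = max (real (fib j)) (\<theta> * real (fib (j - 1)))"

text \<open>Closeness to \<open>golden_ratio\<close> is encoded by the finitely many inequalities
  that the argument uses: for each index up to \<open>n\<close>, parity selects the larger entry of
  the pair as it does at \<open>golden_ratio\<close>.\<close>

definition good_ratio :: "nat \<Rightarrow> real \<Rightarrow> bool" where
  "good_ratio n \<theta> \<longleftrightarrow> \<theta> \<ge> 1 \<and>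
     (\<forall>j\<in>{1..n}. if odd j then \<theta> * real (fib (j - 1)) \<le> real (fib j)
                 else real (fib j) \<le> \<theta> * real (fib (j - 1)))"

lemma fib_height_odd:
  assumes "good_ratio n \<theta>" "j \<in> {1..n}" "odd j"
  shows "fib_height \<theta> j = real (fib j)"
proof -
  have "\<theta> * real (fib (j - 1)) \<le> real (fib j)"
    using assms unfolding good_ratio_def by metis
  then show ?thesis by (simp add: fib_height_def max_def)
qed

lemma fib_height_even:
  assumes "good_ratio n \<theta>" "j \<in> {1..n}" "even j"
  shows "fib_height \<theta> j = \<theta> * real (fib (j - 1))"
proof -
  have "real (fib j) \<le> \<theta> * real (fib (j - 1))"
    using assms unfolding good_ratio_def by metis
  then show ?thesis by (simp add: fib_height_def max_def)
qed

text \<open>On the side of the line where (u, w) lies, all pieces have one parity, so their heights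
  add up to \<open>u\<close> or to \<open>\<theta> * w\<close>, and superadditivity of the power
  applies. The bound \<open>u \<le> fib n\<close> keeps the indices in the range controlled by
  \<open>good_ratio\<close>.\<close>

lemma fib_height_decomposition:
  assumes n: "n \<ge> 3" and good: "good_ratio n \<theta>" and s: "s \<ge> 1"
    and w: "w \<le> u" "u \<le> fib n"
  shows "\<exists>js. set js \<subseteq> {1..n} \<and> sum_list (map fib js) = u \<and>
           sum_list (map (\<lambda>j. fib (j - 1)) js) = w \<and>
           (\<Sum>j\<leftarrow>js. fib_height \<theta> j powr s) \<le> max (real u) (\<theta> * real w) powr s"
proof (cases "w = 0")
  case True
  \<comment> \<open>For \<open>w = 0\<close> the pieces are \<open>u\<close> copies of (1, 0), each
    of height 1. The case is split off because (0, 0) lies on the separating line.\<close>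
  have "(\<Sum>j\<leftarrow>replicate u (1::nat). fib_height \<theta> j powr s) = real u"
    using good by (simp add: fib_height_def sum_list_replicate)
  also have "\<dots> \<le> real u powr s"
  proof (cases "u = 0")
    case False
    then have "real u powr 1 \<le> real u powr s" using s by (intro powr_mono) auto
    then show ?thesis by simp
  qed simp
  finally show ?thesis using True w n
    by (intro exI[of _ "replicate u 1"]) (auto simp: sum_list_replicate)
next
  case False
  have sub: "set js \<subseteq> {1..n}" if "sum_list (map fib js) = u" "0 \<notin> set js" for js
  proof
    fix j assume j: "j \<in> set js"
    then have "fib j \<le> u" unfolding that(1)[symmetric] by (intro member_le_sum_list) auto
    then have "fib j \<le> fib n" using w by simp
    then have "j \<le> n" using n by (rule fib_le_fib_imp_le)
    moreover have "j \<noteq> 0" using j that(2) by metis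
    ultimately show "j \<in> {1..n}" by simp
  qed
  have th: "\<theta> \<ge> 1" using good by (simp add: good_ratio_def)
  consider "golden_ratio * real w < real u" | "real u < golden_ratio * real w"
    using golden_ratio_mult_nat_neq[of w u] False by force
  then show ?thesis
  proof cases
    case 1
    then obtain js where js: "\<forall>j\<in>set js. odd j" "sum_list (map fib js) = u"
        "sum_list (map (\<lambda>j. fib (j - 1)) js) = w"
      using odd_fib_decomposition by blast
    have "set js \<subseteq> {1..n}" using js by (intro sub) auto
    then have "(\<Sum>j\<leftarrow>js. fib_height \<theta> j powr s) = (\<Sum>x\<leftarrow>map (\<lambda>j. real (fib j)) js. x powr s)"
      unfolding map_map o_def using js(1) fib_height_odd[OF good]
      by (intro arg_cong[of _ _ sum_list] map_cong) (auto simp: subset_iff)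
    also have "\<dots> \<le> (sum_list (map (\<lambda>j. real (fib j)) js)) powr s"
      using s by (intro powr_sum_list_superadditive) auto
    also have "sum_list (map (\<lambda>j. real (fib j)) js) = real (sum_list (map fib js))"
      by (induction js) auto
    also have "\<dots> powr s \<le> max (real u) (\<theta> * real w) powr s"
      using js s by (intro powr_mono2) auto
    finally show ?thesis using js \<open>set js \<subseteq> {1..n}\<close> by blast
  next
    case 2
    then obtain js where js: "\<forall>j\<in>set js. even j \<and> j > 0" "sum_list (map fib js) = u"
        "sum_list (map (\<lambda>j. fib (j - 1)) js) = w"
      using even_fib_decomposition w by blast
    have "set js \<subseteq> {1..n}" using js by (intro sub) auto
    then have "(\<Sum>j\<leftarrow>js. fib_height \<theta> j powr s) = (\<Sum>x\<leftarrow>map (\<lambda>j. \<theta> * real (fib (j - 1))) js. x powr s)"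
      unfolding map_map o_def using js(1) fib_height_even[OF good]
      by (intro arg_cong[of _ _ sum_list] map_cong) (auto simp: subset_iff)
    also have "\<dots> \<le> (sum_list (map (\<lambda>j. \<theta> * real (fib (j - 1))) js)) powr s"
      using s th by (intro powr_sum_list_superadditive) auto
    also have "sum_list (map (\<lambda>j. \<theta> * real (fib (j - 1))) js) = \<theta> * real (sum_list (map (\<lambda>j. fib (j - 1)) js))"
      by (induction js) (auto simp: algebra_simps)
    also have "\<dots> powr s \<le> max (real u) (\<theta> * real w) powr s"
      using js s th by (intro powr_mono2) auto
    finally show ?thesis using js \<open>set js \<subseteq> {1..n}\<close> by blast
  qed
qed

lemma lattice_partition_lower_bound:
  assumes n: "n \<ge> 3" and good: "good_ratio n \<theta>" and s: "s > 0"
    and m: "\<And>y. y \<in> Fplus n \<Longrightarrow> m \<le> (\<Sum>i=1..n. y i * fib_height \<theta> i powr s)"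
    and le: "\<forall>p\<in>set ps. snd p \<le> fst p"
    and u: "sum_list (map fst ps) = fib n" and w: "sum_list (map snd ps) = fib (n - 1)"
  shows "m \<le> (\<Sum>p\<leftarrow>ps. max (real (fst p)) (\<theta> * real (snd p)) powr s)"
proof (cases "s \<ge> 1")
  case False
  have th: "\<theta> \<ge> 1" using good by (simp add: good_ratio_def)
  \<comment> \<open>For \<open>s < 1\<close> splitting into pieces no longer helps, so all pairs are
    merged instead: the sum of the heights is at least the height of the total, and the power is
    subadditive.\<close>
  define h where "h = (\<lambda>p :: nat \<times> nat. max (real (fst p)) (\<theta> * real (snd p)))"
  have n2: "n \<ge> 2" using n by simp
  have "m \<le> fib_height \<theta> n powr s"
    using m[OF yvec_last_in_Fplus(1)[OF n2]] unfolding yvec_last_in_Fplus(2)[OF n2] .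
  also have "fib_height \<theta> n \<le> sum_list (map h ps)"
    unfolding fib_height_def
  proof (rule max.boundedI)
    have "real (fib n) = (\<Sum>p\<leftarrow>ps. real (fst p))" unfolding u[symmetric] by (induction ps) auto
    also have "\<dots> \<le> sum_list (map h ps)" by (intro sum_list_mono) (auto simp: h_def)
    finally show "real (fib n) \<le> sum_list (map h ps)" .
    have "\<theta> * real (fib (n - 1)) = (\<Sum>p\<leftarrow>ps. \<theta> * real (snd p))"
      unfolding w[symmetric] by (induction ps) (auto simp: algebra_simps)
    also have "\<dots> \<le> sum_list (map h ps)" by (intro sum_list_mono) (auto simp: h_def)
    finally show "\<theta> * real (fib (n - 1)) \<le> sum_list (map h ps)" .
  qed
  then have "fib_height \<theta> n powr s \<le> sum_list (map h ps) powr s"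
    using s by (intro powr_mono2) (auto simp: fib_height_def)
  also have "\<dots> \<le> (\<Sum>x\<leftarrow>map h ps. x powr s)"
    using False by (intro powr_sum_list_subadditive) (auto simp: h_def)
  finally show ?thesis by (simp add: h_def o_def)
next
  case True
  have "\<forall>p\<in>set ps. \<exists>js. set js \<subseteq> {1..n} \<and> sum_list (map fib js) = fst p \<and>
           sum_list (map (\<lambda>j. fib (j - 1)) js) = snd p \<and>
           (\<Sum>j\<leftarrow>js. fib_height \<theta> j powr s) \<le> max (real (fst p)) (\<theta> * real (snd p)) powr s"
  proof
    fix p assume p: "p \<in> set ps"
    then have "fst p \<le> fib n" unfolding u[symmetric] by (intro member_le_sum_list) auto
    with le p show "\<exists>js. set js \<subseteq> {1..n} \<and> sum_list (map fib js) = fst p \<and>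
           sum_list (map (\<lambda>j. fib (j - 1)) js) = snd p \<and>
           (\<Sum>j\<leftarrow>js. fib_height \<theta> j powr s) \<le> max (real (fst p)) (\<theta> * real (snd p)) powr s"
      by (intro fib_height_decomposition n good True) auto
  qed
  then obtain J where J: "\<forall>p\<in>set ps. set (J p) \<subseteq> {1..n} \<and> sum_list (map fib (J p)) = fst p \<and>
           sum_list (map (\<lambda>j. fib (j - 1)) (J p)) = snd p \<and>
           (\<Sum>j\<leftarrow>J p. fib_height \<theta> j powr s) \<le> max (real (fst p)) (\<theta> * real (snd p)) powr s"
    by metis
  define js where "js = concat (map J ps)"
  have js: "set js \<subseteq> {1..n}" using J by (auto simp: js_def)
  have *: "(\<Sum>j\<leftarrow>js. f j) = (\<Sum>p\<leftarrow>ps. \<Sum>j\<leftarrow>J p. f j)" for f :: "nat \<Rightarrow> real"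
    unfolding js_def by (induction ps) auto
  have r: "(\<Sum>j\<leftarrow>xs. real (f j)) = real (\<Sum>j\<leftarrow>xs. f j)" for f :: "'z \<Rightarrow> nat" and xs
    by (induction xs) auto
  note count = sum_list_eq_sum_count_list[OF js finite_atLeastAtMost, symmetric]
  \<comment> \<open>The multiplicities of the indices form a feasible point of the linear program;
    their integrality is simply forgotten.\<close>
  have "m \<le> (\<Sum>i=1..n. real (count_list js i) * fib_height \<theta> i powr s)"
  proof (rule linear_lower_bound_Fplus)
    have "(\<Sum>i=1..n. real (count_list js i) * real (fib i)) = (\<Sum>p\<leftarrow>ps. real (fst p))"
      unfolding count * using J by (intro arg_cong[of _ _ sum_list] map_cong) (auto simp: r)
    then show "(\<Sum>i=1..n. real (count_list js i) * real (fib i)) = real (fib n)"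
      unfolding r u .
    have "(\<Sum>i=1..n. real (count_list js i) * real (fib (i - 1))) = (\<Sum>p\<leftarrow>ps. real (snd p))"
      unfolding count * using J by (intro arg_cong[of _ _ sum_list] map_cong) (auto simp: r)
    then show "(\<Sum>i=1..n. real (count_list js i) * real (fib (i - 1))) = real (fib (n - 1))"
      unfolding r w .
  qed (use n m in auto)
  also have "\<dots> = (\<Sum>p\<leftarrow>ps. \<Sum>j\<leftarrow>J p. fib_height \<theta> j powr s)"
    unfolding count * ..
  also have "\<dots> \<le> (\<Sum>p\<leftarrow>ps. max (real (fst p)) (\<theta> * real (snd p)) powr s)"
    using J by (intro sum_list_mono) auto
  finally show ?thesis .
qed

section \<open>Mahler measures of the factors\<close>

interpretation int_module: Modules.module "\<lambda>(a :: int) (x :: complex). of_int a * x"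
  by standard (auto simp: algebra_simps)

text \<open>The classical criterion for integrality: multiplication by x preserves a finitely
  generated group. The element 1 makes this group nonzero and later guarantees a nonzero
  eigenvector.\<close>

definition int_stable :: "complex \<Rightarrow> complex set \<Rightarrow> bool" where
  "int_stable x S \<longleftrightarrow> finite S \<and> 1 \<in> S \<and> (\<forall>s\<in>S. x * s \<in> int_module.span S)"

lemma int_span_mult:
  assumes u: "u \<in> int_module.span S" and v: "v \<in> int_module.span T"
  shows "u * v \<in> int_module.span {s * t | s t. s \<in> S \<and> t \<in> T}" (is "_ \<in> int_module.span ?ST")
proof -
  have 1: "s * v \<in> int_module.span ?ST" if s: "s \<in> S" for s
  proof (rule int_module.span_induct[OF v])
    show "int_module.subspace {v. s * v \<in> int_module.span ?ST}"
    proof (rule int_module.subspaceI)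
      fix c :: int and y assume "y \<in> {v. s * v \<in> int_module.span ?ST}"
      then have "of_int c * (s * y) \<in> int_module.span ?ST" by (auto intro: int_module.span_scale)
      then show "of_int c * y \<in> {v. s * v \<in> int_module.span ?ST}" by (simp add: algebra_simps)
    qed (auto simp: distrib_left intro: int_module.span_zero int_module.span_add)
    show "s * t \<in> int_module.span ?ST" if "t \<in> T" for t
      using s that by (intro int_module.span_base) auto
  qed
  show ?thesis
  proof (rule int_module.span_induct[OF u])
    show "int_module.subspace {u. u * v \<in> int_module.span ?ST}"
    proof (rule int_module.subspaceI)
      fix c :: int and y assume "y \<in> {u. u * v \<in> int_module.span ?ST}"
      then have "of_int c * (y * v) \<in> int_module.span ?ST" by (auto intro: int_module.span_scale)
      then show "of_int c * y \<in> {u. u * v \<in> int_module.span ?ST}" by (simp add: algebra_simps)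
    qed (auto simp: distrib_right intro: int_module.span_zero int_module.span_add)
  qed (use 1 in auto)
qed

text \<open>\<open>x * s\<close> and \<open>y * t\<close> expand in their own generators, so the
  products of generators are stable under \<open>x * y\<close>. This yields products of algebraic
  integers without exhibiting a polynomial.\<close>

lemma int_stable_mult:
  assumes "int_stable x S" "int_stable y T"
  shows "int_stable (x * y) {s * t | s t. s \<in> S \<and> t \<in> T}"
proof -
  have "{s * t | s t. s \<in> S \<and> t \<in> T} = (\<lambda>(s, t). s * t) ` (S \<times> T)" by auto
  then have "finite {s * t | s t. s \<in> S \<and> t \<in> T}"
    using assms by (simp add: int_stable_def)
  moreover have "1 \<in> {s * t | s t. s \<in> S \<and> t \<in> T}"
    using assms by (auto simp: int_stable_def intro!: exI[of _ 1])
  moreover have "x * y * (s * t) \<in> int_module.span {s * t | s t. s \<in> S \<and> t \<in> T}"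
    if "s \<in> S" "t \<in> T" for s t
    using int_span_mult[of "x * s" S "y * t" T] assms that
    by (simp add: int_stable_def algebra_simps)
  ultimately show ?thesis by (auto simp: int_stable_def)
qed

lemma int_stable_1: "int_stable 1 {1}"
  by (auto simp: int_stable_def intro: int_module.span_base)

lemma int_stable_prod:
  assumes "finite I" "\<And>i. i \<in> I \<Longrightarrow> \<exists>S. int_stable (x i) S"
  shows "\<exists>S. int_stable (\<Prod>i\<in>I. x i) S"
  using assms
proof (induction I rule: finite_induct)
  case (insert i I)
  then obtain S T where "int_stable (x i) S" "int_stable (\<Prod>i\<in>I. x i) T"
    by (metis insertCI)
  then have "int_stable (x i * (\<Prod>i\<in>I. x i)) {s * t | s t. s \<in> S \<and> t \<in> T}"
    by (rule int_stable_mult)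
  then show ?case using insert.hyps by auto
qed (use int_stable_1 in auto)

text \<open>Enumerating \<open>S\<close>, multiplication by \<open>x\<close> is given by an integer matrix with eigenvalue \<open>x\<close>.\<close>

lemma int_stable_imp_algebraic_int:
  assumes "int_stable x S"
  shows "algebraic_int x"
proof -
  have fin: "finite S" and one: "1 \<in> S" and st: "\<And>s. s \<in> S \<Longrightarrow> x * s \<in> int_module.span S"
    using assms by (auto simp: int_stable_def)
  obtain ss where ss: "set ss = S" "distinct ss" using fin finite_distinct_list by blast
  define n where "n = length ss"
  have "\<forall>i<n. \<exists>u :: complex \<Rightarrow> int. x * ss ! i = (\<Sum>v\<in>S. of_int (u v) * v)"
  proof (intro allI impI)
    fix i assume "i < n"
    then have "ss ! i \<in> S" using ss by (auto simp: n_def)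
    from st[OF this] show "\<exists>u :: complex \<Rightarrow> int. x * ss ! i = (\<Sum>v\<in>S. of_int (u v) * v)"
      unfolding int_module.span_finite[OF fin] by auto
  qed
  then obtain u :: "nat \<Rightarrow> complex \<Rightarrow> int"
    where u: "\<And>i. i < n \<Longrightarrow> x * ss ! i = (\<Sum>v\<in>S. of_int (u i v) * v)" by metis
  have bij: "bij_betw (\<lambda>i. ss ! i) {0..<n} S"
    using bij_betw_nth[OF ss(2), of "{0..<n}" S] ss by (auto simp: n_def atLeast0LessThan)
  define M :: "int Matrix.mat" where "M = Matrix.mat n n (\<lambda>(i, j). u i (ss ! j))"
  define M' :: "complex Matrix.mat" where "M' = map_mat of_int M"
  define v where "v = Matrix.vec n (\<lambda>i. ss ! i)"
  have M: "M \<in> carrier_mat n n" and M': "M' \<in> carrier_mat n n" by (auto simp: M_def M'_def)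
  have "M' *\<^sub>v v = x \<cdot>\<^sub>v v"
  proof (rule eq_vecI)
    fix i assume "i < dim_vec (x \<cdot>\<^sub>v v)"
    then have i: "i < n" by (simp add: v_def)
    have "vec_index (M' *\<^sub>v v) i = (\<Sum>j = 0..<n. of_int (u i (ss ! j)) * ss ! j)"
      using i by (simp add: M'_def M_def v_def scalar_prod_def)
    also have "\<dots> = (\<Sum>v\<in>S. of_int (u i v) * v)"
      by (rule sum.reindex_bij_betw[OF bij])
    finally show "vec_index (M' *\<^sub>v v) i = vec_index (x \<cdot>\<^sub>v v) i"
      using u[OF i] i by (simp add: v_def)
  qed (auto simp: M'_def M_def v_def)
  moreover have "v \<noteq> 0\<^sub>v n"
  proof
    assume v: "v = 0\<^sub>v n"
    obtain i where i: "i < n" "ss ! i = 1" using one ss unfolding n_def by (metis in_set_conv_nth)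
    then have "vec_index v i = 1" by (simp add: v_def)
    then show False using v i by simp
  qed
  ultimately have "eigenvector M' v x"
    using M' by (auto simp: eigenvector_def v_def)
  then have "eigenvalue M' x" unfolding eigenvalue_def by blast
  then have "poly (char_poly M') x = 0" using eigenvalue_root_char_poly[OF M'] by simp
  moreover have "char_poly M' = map_poly of_int (char_poly M)"
    unfolding M'_def by (rule of_int_hom.char_poly_hom[OF M])
  moreover have "lead_coeff (char_poly M) = 1"
    using degree_monic_char_poly[OF M] by auto
  ultimately show ?thesis unfolding algebraic_int_altdef_ipoly by auto
qed

text \<open>With a the leading coefficient and d the degree, multiplying P(x) = 0 by a^(d-1) gives a
  monic integer equation of degree d for y = a x. Hence 1, y, ..., y^(d-1) generate a stable
  group.\<close>

lemma int_stable_lead_coeff_mult: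
  fixes P :: "int poly"
  assumes root: "poly (map_poly of_int P) x = 0" and deg: "degree P > 0"
  shows "\<exists>S. int_stable (of_int (lead_coeff P) * x) S"
proof -
  define d where "d = degree P"
  define a where "a = lead_coeff P"
  define y where "y = of_int a * x"
  define S where "S = (\<lambda>i. y ^ i) ` {..<d}"
  have d: "d > 0" using deg by (simp add: d_def)
  have pw: "y ^ i \<in> int_module.span S" if "i < d" for i
    using that by (intro int_module.span_base) (auto simp: S_def)
  have "(\<Sum>i\<le>d. of_int (coeff P i) * x ^ i) = 0"
    using root by (simp add: poly_altdef coeff_map_poly degree_map_poly d_def)
  then have "of_int a * x ^ d = - (\<Sum>i<d. of_int (coeff P i) * x ^ i)"
    by (simp add: a_def d_def lessThan_Suc_atMost[symmetric] eq_neg_iff_add_eq_0 add.commute)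
  then have "of_int (a ^ (d - 1)) * (of_int a * x ^ d) =
      of_int (a ^ (d - 1)) * (- (\<Sum>i<d. of_int (coeff P i) * x ^ i))" by simp
  also have "of_int (a ^ (d - 1)) * (of_int a * x ^ d) = y ^ d"
    using d by (simp add: y_def power_mult_distrib power_eq_if[of "of_int a" d])
  also have "of_int (a ^ (d - 1)) * (- (\<Sum>i<d. of_int (coeff P i) * x ^ i)) =
      (\<Sum>i<d. of_int (- (coeff P i * a ^ (d - 1 - i))) * y ^ i)"
    unfolding sum_negf[symmetric] sum_distrib_left
  proof (intro sum.cong refl)
    fix i assume "i \<in> {..<d}"
    then have "a ^ (d - 1) = a ^ (d - 1 - i) * a ^ i" by (simp add: power_add[symmetric])
    then show "of_int (a ^ (d - 1)) * - (of_int (coeff P i) * x ^ i) =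
        of_int (- (coeff P i * a ^ (d - 1 - i))) * y ^ i"
      by (simp add: y_def power_mult_distrib algebra_simps)
  qed
  finally have "y ^ d \<in> int_module.span S"
    using pw by (simp only:) (intro int_module.span_sum int_module.span_scale; simp)
  moreover have "y * y ^ i \<in> int_module.span S" if "i < d" for i
    using that pw[of "Suc i"] calculation by (cases "Suc i = d") auto
  moreover have "1 \<in> S" using d by (auto simp: S_def intro!: image_eqI[of _ _ 0])
  ultimately have "int_stable y S" by (auto simp: int_stable_def S_def)
  then show ?thesis by (auto simp: y_def a_def)
qed

section \<open>Minimal polynomials and bounds for the Mahler measure\<close>

lemma min_int_poly:
  assumes "algebraic x"
  shows "irreducible (min_int_poly x)" "lead_coeff (min_int_poly x) > 0"
    "poly (map_poly of_int (min_int_poly x)) x = 0"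
proof -
  have "is_min_int_poly x (min_int_poly x)"
    unfolding min_int_poly_def by (rule theI'[OF ex1_min_int_poly[OF assms]])
  then show "irreducible (min_int_poly x)" "lead_coeff (min_int_poly x) > 0"
    "poly (map_poly of_int (min_int_poly x)) x = 0" by (auto simp: is_min_int_poly_def)
qed

lemma min_int_poly_eqI:
  assumes "irreducible P" "lead_coeff P > 0" "poly (map_poly of_int P) x = 0"
  shows "min_int_poly x = P"
proof -
  have "P \<noteq> 0" using assms by auto
  then have "algebraic x" using assms(3) by (intro algebraicI') auto
  from ex1_min_int_poly[OF this] show ?thesis
    unfolding min_int_poly_def using assms by (intro the1_equality) (auto simp: is_min_int_poly_def)
qed

lemma degree_min_int_poly_pos:
  assumes "algebraic x"
  shows "degree (min_int_poly x) > 0"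
proof (rule ccontr)
  assume "\<not> ?thesis"
  then obtain c where c: "min_int_poly x = [:c:]" by (metis degree_eq_zeroE gr0I)
  then show False using min_int_poly[OF assms] by (auto simp: map_poly_pCons)
qed

text \<open>Otherwise z divides the irreducible polynomial, which is then a constant multiple of z
  and has 0 as its only root.\<close>

lemma coeff_0_min_int_poly_nonzero:
  assumes "algebraic x" "x \<noteq> 0"
  shows "coeff (min_int_poly x) 0 \<noteq> 0"
proof
  assume "coeff (min_int_poly x) 0 = 0"
  then obtain Q where Q: "min_int_poly x = pCons 0 Q"
    by (cases "min_int_poly x") auto
  then have "min_int_poly x = [:0, 1:] * Q" by simp
  moreover have "\<not> is_unit ([:0, 1:] :: int poly)"
    by (auto simp: is_unit_poly_iff)
  ultimately have "is_unit Q"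
    using irreducibleD[OF min_int_poly(1)[OF assms(1)]] by blast
  then obtain c where c: "Q = [:c:]" "is_unit c" by (auto simp: is_unit_poly_iff)
  then have "min_int_poly x = [:0, c:]" using Q by simp
  then have "poly (map_poly of_int [:0, c:]) x = 0" using min_int_poly(3)[OF assms(1)] by simp
  moreover have "map_poly of_int [:0, c:] = ([:0, of_int c:] :: complex poly)"
    by (simp add: Polynomial.map_poly_pCons)
  ultimately have "of_int c * x = 0" by auto
  then show False using assms c by auto
qed

lemma ln_lead_coeff_le_log_mahler:
  assumes "algebraic x"
  shows "ln (real_of_int (lead_coeff (min_int_poly x))) \<le> log_mahler x"
proof -
  have "0 \<le> (\<Sum>\<beta>\<in>#proots (map_poly of_int (min_int_poly x) :: complex poly). ln (max 1 (cmod \<beta>)))"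
    using sum_mset_mono[of "proots (map_poly of_int (min_int_poly x))" "\<lambda>_. 0" "\<lambda>\<beta>. ln (max 1 (cmod \<beta>))"]
    by simp
  then show ?thesis using min_int_poly(2)[OF assms] by (simp add: log_mahler_def)
qed

text \<open>Up to sign the constant coefficient is the leading one times the product of the roots,
  and each root is at most \<open>max 1 (cmod \<beta>)\<close> in modulus.\<close>

lemma ln_coeff_0_le_log_mahler:
  assumes "algebraic x" "x \<noteq> 0"
  shows "ln (real_of_int \<bar>coeff (min_int_poly x) 0\<bar>) \<le> log_mahler x"
proof -
  define P where "P = min_int_poly x"
  define P' where "P' = (map_poly of_int P :: complex poly)"
  define a where "a = real_of_int (lead_coeff P)"
  have a: "a > 0" using min_int_poly(2)[OF assms(1)] by (simp add: a_def P_def)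
  have lc: "lead_coeff P' = of_int (lead_coeff P)" by (simp add: P'_def degree_map_poly coeff_map_poly)
  have "P' = Polynomial.smult (lead_coeff P') (\<Prod>\<beta>\<in>#proots P'. [:- \<beta>, 1:])"
    by (rule complex_poly_decompose_multiset[symmetric])
  then have "poly P' 0 = poly (Polynomial.smult (lead_coeff P') (\<Prod>\<beta>\<in>#proots P'. [:- \<beta>, 1:])) 0"
    by (rule arg_cong)
  also have "\<dots> = lead_coeff P' * (\<Prod>\<beta>\<in>#proots P'. - \<beta>)"
    unfolding poly_smult poly_prod_mset by simp
  finally have "coeff P' 0 = lead_coeff P' * (\<Prod>\<beta>\<in>#proots P'. - \<beta>)"
    by (simp add: poly_0_coeff_0)
  then have eq: "cmod (coeff P' 0) = a * cmod (\<Prod>\<beta>\<in>#proots P'. - \<beta>)"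
    using a by (simp add: norm_mult lc a_def)
  have pos: "0 < (\<Prod>\<beta>\<in>#M. max 1 (cmod \<beta>))" for M by (induction M) auto
  have "cmod (\<Prod>\<beta>\<in>#M. - \<beta>) \<le> (\<Prod>\<beta>\<in>#M. max 1 (cmod \<beta>))" for M
  proof (induction M)
    case (add y M)
    have "cmod y * cmod (\<Prod>\<beta>\<in>#M. - \<beta>) \<le> max 1 (cmod y) * (\<Prod>\<beta>\<in>#M. max 1 (cmod \<beta>))"
      using add by (intro mult_mono) auto
    then show ?case by (simp add: norm_mult)
  qed simp
  then have "cmod (coeff P' 0) \<le> a * (\<Prod>\<beta>\<in>#proots P'. max 1 (cmod \<beta>))"
    unfolding eq using a by simp
  moreover have "cmod (coeff P' 0) = real_of_int \<bar>coeff P 0\<bar>"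
    by (simp add: P'_def coeff_map_poly)
  moreover have "real_of_int \<bar>coeff P 0\<bar> > 0"
    using coeff_0_min_int_poly_nonzero[OF assms] by (simp add: P_def)
  ultimately have "ln (real_of_int \<bar>coeff P 0\<bar>) \<le> ln (a * (\<Prod>\<beta>\<in>#proots P'. max 1 (cmod \<beta>)))"
    by (subst ln_le_cancel_iff) (use a pos in auto)
  also have "\<dots> = ln a + ln (\<Prod>\<beta>\<in>#proots P'. max 1 (cmod \<beta>))"
    using a pos[of "proots P'"] by (intro ln_mult_pos) auto
  also have "ln (\<Prod>\<beta>\<in>#M. max 1 (cmod \<beta>)) = (\<Sum>\<beta>\<in>#M. ln (max 1 (cmod \<beta>)))" for M
  proof (induction M)
    case (add y M)
    have "ln (max 1 (cmod y) * (\<Prod>\<beta>\<in>#M. max 1 (cmod \<beta>))) =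
        ln (max 1 (cmod y)) + ln (\<Prod>\<beta>\<in>#M. max 1 (cmod \<beta>))"
      using pos[of M] by (intro ln_mult_pos) auto
    then show ?case using add by simp
  qed simp
  finally show ?thesis using a by (simp add: log_mahler_def P_def P'_def a_def)
qed

lemma irreducible_linear_int_poly:
  assumes "coprime a b" "b \<noteq> 0"
  shows "irreducible ([:a, b:] :: int poly)"
proof (rule irreducibleI)
  show "[:a, b:] \<noteq> 0" "\<not> is_unit [:a, b:]" using assms by (auto simp: is_unit_poly_iff)
  have const: "is_unit A" if eq: "[:a, b:] = A * B" and deg: "degree A = 0" for A B :: "int poly"
  proof -
    obtain c where c: "A = [:c:]" using degree_eq_zeroE[OF deg] .
    have "coeff [:a, b:] i = c * coeff B i" for i unfolding eq c by simp
    from this[of 0] this[of 1] have "a = c * coeff B 0" "b = c * coeff B 1" by simp_all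
    then have "c dvd a" "c dvd b" by (metis dvd_triv_left)+
    then have "is_unit c" using assms(1) by (rule coprime_common_divisor[rotated])
    then show ?thesis using c by (simp add: is_unit_poly_iff)
  qed
  fix A B :: "int poly" assume AB: "[:a, b:] = A * B"
  have "A \<noteq> 0" "B \<noteq> 0" using AB assms by auto
  then have "degree A + degree B = degree [:a, b:]" unfolding AB by (simp add: degree_mult_eq)
  also have "\<dots> = 1" using assms(2) by simp
  finally have "degree A + degree B = 1" .
  then have "degree A = 0 \<or> degree B = 0" by linarith
  then show "is_unit A \<or> is_unit B" using const[of A B] const[of B A] AB by (auto simp: mult.commute)
qed

lemma log_mahler_quotient:
  fixes a b :: nat
  assumes "coprime a b" "a > 0" "b > 0"
  shows "log_mahler (of_nat a / of_nat b) = max (ln (real a)) (ln (real b))"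
proof -
  define x where "x = (of_nat a / of_nat b :: complex)"
  define P where "P = [:- int a, int b:]"
  have "irreducible P" unfolding P_def using assms by (intro irreducible_linear_int_poly) auto
  then have P: "min_int_poly x = P"
    using assms by (intro min_int_poly_eqI) (auto simp: P_def x_def map_poly_pCons)
  have "map_poly of_int P = Polynomial.smult (of_nat b) [:- x, 1:]"
    using assms by (simp add: P_def x_def map_poly_pCons)
  then have "proots (map_poly of_int P) = {#x#}"
    using assms proots_smult[of "of_nat b" "[:- x, 1:]"] by (simp del: smult_pCons)
  then have "log_mahler x = ln (real b) + ln (max 1 (real a / real b))"
    using assms unfolding log_mahler_def P by (simp add: P_def x_def norm_divide)
  also have "\<dots> = max (ln (real a)) (ln (real b))"
  proof (cases "a \<le> b")
    case True
    then have "max 1 (real a / real b) = 1" using assms by (simp add: max_def field_simps)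
    moreover have "ln (real a) \<le> ln (real b)" using True assms by simp
    ultimately show ?thesis by (simp add: max_def)
  next
    case False
    then have "max 1 (real a / real b) = real a / real b" using assms by (simp add: max_def field_simps)
    moreover have "ln (real b) \<le> ln (real a)" using False assms by simp
    ultimately show ?thesis using assms by (simp add: ln_div max_def)
  qed
  finally show ?thesis by (simp add: x_def)
qed

text \<open>Greedy choice: the last value is taken as large as its upper bound and the lower bounds
  of the others allow. It serves to cut exponents that are only bounded in total down to exact
  sums.\<close>

lemma interpolate_nat_sum:
  fixes lo hi :: "nat \<Rightarrow> nat"
  assumes "\<forall>i<N. lo i \<le> hi i" "(\<Sum>i<N. lo i) \<le> M" "M \<le> (\<Sum>i<N. hi i)"
  shows "\<exists>f. (\<forall>i<N. lo i \<le> f i \<and> f i \<le> hi i) \<and> (\<Sum>i<N. f i) = M"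
  using assms
proof (induction N arbitrary: M)
  case (Suc N)
  define y where "y = min (hi N) (M - (\<Sum>i<N. lo i))"
  have y: "lo N \<le> y" "y \<le> hi N" "y \<le> M" using Suc.prems by (auto simp: y_def)
  have "(\<Sum>i<N. lo i) \<le> M - y" "M - y \<le> (\<Sum>i<N. hi i)"
  proof -
    have "(\<Sum>i<N. lo i) \<le> (\<Sum>i<N. hi i)" using Suc.prems by (intro sum_mono) auto
    then show "(\<Sum>i<N. lo i) \<le> M - y" "M - y \<le> (\<Sum>i<N. hi i)"
      using Suc.prems by (auto simp: y_def)
  qed
  then obtain f where f: "\<forall>i<N. lo i \<le> f i \<and> f i \<le> hi i" "(\<Sum>i<N. f i) = M - y"
    using Suc.IH[of "M - y"] Suc.prems by auto
  define f' where "f' = f(N := y)"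
  have "(\<Sum>i<N. f' i) = (\<Sum>i<N. f i)" by (intro sum.cong) (auto simp: f'_def)
  then have "(\<Sum>i<Suc N. f' i) = M" using f y by (simp add: f'_def)
  moreover have "\<forall>i<Suc N. lo i \<le> f' i \<and> f' i \<le> hi i" using f y by (auto simp: f'_def less_Suc_eq)
  ultimately show ?case by blast
qed simp

text \<open>Each leading coefficient times its root is an algebraic integer. So the product A of the
  leading coefficients makes A * a / b a rational algebraic integer, that is, an integer, and
  coprimality gives b dvd A.\<close>

lemma denominator_dvd_prod_lead_coeff:
  fixes P :: "nat \<Rightarrow> int poly" and x :: "nat \<Rightarrow> complex" and a b :: nat
  assumes root: "\<And>i. i < N \<Longrightarrow> poly (map_poly of_int (P i)) (x i) = 0"
    and deg: "\<And>i. i < N \<Longrightarrow> degree (P i) > 0"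
    and prod: "(\<Prod>i<N. x i) = of_nat a / of_nat b" and co: "coprime a b" and b: "b > 0"
  shows "int b dvd (\<Prod>i<N. lead_coeff (P i))"
proof -
  define A where "A = (\<Prod>i<N. lead_coeff (P i))"
  have "\<exists>S. int_stable (\<Prod>i<N. of_int (lead_coeff (P i)) * x i) S"
    using root deg by (intro int_stable_prod int_stable_lead_coeff_mult) auto
  then have "algebraic_int (\<Prod>i<N. of_int (lead_coeff (P i)) * x i)"
    using int_stable_imp_algebraic_int by blast
  also have "(\<Prod>i<N. of_int (lead_coeff (P i)) * x i) = of_int A * (of_nat a / of_nat b)"
    by (simp add: prod.distrib prod A_def)
  finally have "of_int A * (of_nat a / of_nat b :: complex) \<in> \<int>"
    by (intro rational_algebraic_int_is_int) auto
  then obtain k where "of_int A * (of_nat a / of_nat b :: complex) = of_int k"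
    by (elim Ints_cases)
  then have "of_int (A * int a) = (of_int (k * int b) :: complex)"
    using b by (simp add: field_simps)
  then have "A * int a = k * int b" by (simp only: of_int_eq_iff)
  then have "int b dvd A * int a" by simp
  then show ?thesis using co unfolding A_def
    by (metis coprime_commute coprime_dvd_mult_left_iff coprime_int_iff)
qed

text \<open>
  The product of the leading coefficients of the minimal polynomials is divisible by \<open>q ^ b\<close>, that
  of the constant coefficients by \<open>p ^ a\<close>. Taking smaller exponents makes both sums exact, and
  since \<open>p < q\<close>, the exponent of \<open>p\<close> may be raised to that of \<open>q\<close> at no cost.
\<close>

lemma factorization_exponents:
  fixes p q a b :: nat
  assumes pq: "prime p" "prime q" "p < q" and ba: "b \<le> a"
    and xs: "xs \<in> factorizations (of_nat p ^ a / of_nat q ^ b)"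
  shows "\<exists>u w. (\<Sum>i<length xs. u i) = a \<and> (\<Sum>i<length xs. w i) = b \<and>
           (\<forall>i<length xs. w i \<le> u i \<and>
              max (real (u i) * ln (real p)) (real (w i) * ln (real q)) \<le> log_mahler (xs ! i))"
proof -
  define N where "N = length xs"
  define x where "x = (\<lambda>i. xs ! i)"
  define P where "P = (\<lambda>i. min_int_poly (x i))"
  have alg: "algebraic (x i)" "x i \<noteq> 0" if "i < N" for i
    using xs that by (auto simp: factorizations_def x_def N_def)
  have prod: "(\<Prod>i<N. x i) = of_nat (p ^ a) / of_nat (q ^ b)"
  proof -
    have "(\<Prod>i<N. x i) = prod_list xs"
      using prod.list_conv_set_nth[of xs] by (simp add: atLeast0LessThan N_def x_def)
    then show ?thesis using xs by (simp add: factorizations_def)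
  qed
  have p0: "p > 0" "q > 0" using pq prime_gt_0_nat by auto
  have co: "coprime (p ^ a) (q ^ b)" using pq by (simp add: primes_coprime)
  have P: "lead_coeff (P i) > 0" "poly (map_poly of_int (P i)) (x i) = 0" if "i < N" for i
    using min_int_poly[OF alg(1)[OF that]] by (simp_all add: P_def)
  have deg: "degree (P i) > 0" if "i < N" for i
    using degree_min_int_poly_pos[OF alg(1)[OF that]] by (simp add: P_def)
  have c0: "coeff (P i) 0 \<noteq> 0" if "i < N" for i
    using coeff_0_min_int_poly_nonzero[OF alg[OF that]] by (simp add: P_def)
  have "int (q ^ b) dvd (\<Prod>i<N. lead_coeff (P i))"
    using P(2) deg prod co p0 by (intro denominator_dvd_prod_lead_coeff[where x = x and a = "p ^ a"]) auto
  then have qd: "int q ^ b dvd (\<Prod>i<N. lead_coeff (P i))" by simp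
  \<comment> \<open>Reciprocal polynomials have the inverse roots, and their leading coefficients
    are the constant ones; numerator and denominator change roles.\<close>
  have "int (p ^ a) dvd (\<Prod>i<N. lead_coeff (reflect_poly (P i)))"
  proof (rule denominator_dvd_prod_lead_coeff[where x = "\<lambda>i. inverse (x i)" and a = "q ^ b"])
    show "(\<Prod>i<N. inverse (x i)) = of_nat (q ^ b) / of_nat (p ^ a)"
      using prod prod_inversef[of x "{..<N}"] by (simp add: o_def)
    fix i assume i: "i < N"
    have "map_poly of_int (reflect_poly (P i)) = (reflect_poly (map_poly of_int (P i)) :: complex poly)"
      by (intro poly_eqI) (auto simp: coeff_map_poly coeff_reflect_poly degree_map_poly)
    then show "poly (map_poly of_int (reflect_poly (P i))) (inverse (x i)) = 0"
      using P(2)[OF i] alg[OF i] by (simp add: poly_reflect_poly_nz)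
    show "degree (reflect_poly (P i)) > 0" using deg[OF i] c0[OF i] by simp
  qed (use co p0 in \<open>auto simp: coprime_commute\<close>)
  also have "(\<Prod>i<N. lead_coeff (reflect_poly (P i))) = (\<Prod>i<N. coeff (P i) 0)"
    using c0 by (intro prod.cong) (auto simp: coeff_reflect_poly)
  finally have pd: "int p ^ a dvd (\<Prod>i<N. coeff (P i) 0)" by simp
  have mult_le: "e \<le> (\<Sum>i<N. multiplicity (int r) (f i))"
    if "prime r" "int r ^ e dvd (\<Prod>i<N. f i)" "\<And>i. i < N \<Longrightarrow> f i \<noteq> 0" for r e and f :: "nat \<Rightarrow> int"
  proof -
    have r: "prime_elem (int r)" using that(1) by simp
    have "(\<Prod>i<N. f i) \<noteq> 0" using that(3) by simp
    then have "e \<le> multiplicity (int r) (\<Prod>i<N. f i)"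
      using that(1,2) by (intro multiplicity_geI) (auto simp: prime_elem_def)
    also have "\<dots> = (\<Sum>i<N. multiplicity (int r) (f i))"
      using that(3) r by (intro prime_elem_multiplicity_prod_distrib) auto
    finally show ?thesis .
  qed
  have ln_le: "real (multiplicity (int r) c) * ln (real r) \<le> ln (real_of_int \<bar>c\<bar>)"
    if "prime r" "c \<noteq> 0" for r c
  proof -
    have "int r ^ multiplicity (int r) c dvd \<bar>c\<bar>" by (simp add: multiplicity_dvd)
    then have "int r ^ multiplicity (int r) c \<le> \<bar>c\<bar>"
      using that by (intro zdvd_imp_le) auto
    then have "real_of_int (int r ^ multiplicity (int r) c) \<le> real_of_int \<bar>c\<bar>" by presburger
    then have "ln (real r ^ multiplicity (int r) c) \<le> ln (real_of_int \<bar>c\<bar>)"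
      using that prime_gt_0_nat[of r] by (subst ln_le_cancel_iff) auto
    then show ?thesis using prime_gt_0_nat[OF that(1)] by (simp add: ln_realpow)
  qed
  define U where "U = (\<lambda>i. multiplicity (int p) (coeff (P i) 0))"
  define W where "W = (\<lambda>i. multiplicity (int q) (lead_coeff (P i)))"
  have "b \<le> (\<Sum>i<N. W i)" unfolding W_def
    using P(1) by (intro mult_le qd pq) force
  then obtain w where w: "\<forall>i<N. 0 \<le> w i \<and> w i \<le> W i" "(\<Sum>i<N. w i) = b"
    using interpolate_nat_sum[of N "\<lambda>_. 0" W b] by auto
  have "a \<le> (\<Sum>i<N. U i)" unfolding U_def using c0 by (intro mult_le pd pq)
  also have "\<dots> \<le> (\<Sum>i<N. max (U i) (w i))" by (intro sum_mono) auto
  finally obtain u where u: "\<forall>i<N. w i \<le> u i \<and> u i \<le> max (U i) (w i)" "(\<Sum>i<N. u i) = a"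
    using interpolate_nat_sum[of N w "\<lambda>i. max (U i) (w i)" a] w ba by auto
  have "max (real (u i) * ln (real p)) (real (w i) * ln (real q)) \<le> log_mahler (x i)"
    if i: "i < N" for i
  proof (rule max.boundedI)
    have lp: "ln (real p) \<ge> 0" "ln (real p) \<le> ln (real q)" using p0 pq by auto
    have "real (w i) * ln (real q) \<le> real (W i) * ln (real q)"
      using w i lp by (intro mult_right_mono) auto
    also have "\<dots> \<le> ln (real_of_int \<bar>lead_coeff (P i)\<bar>)" unfolding W_def
      using P(1)[OF i] by (intro ln_le pq) auto
    also have "\<dots> \<le> log_mahler (x i)"
      using ln_lead_coeff_le_log_mahler[OF alg(1)[OF i]] P(1)[OF i] by (simp add: P_def)
    finally show q: "real (w i) * ln (real q) \<le> log_mahler (x i)" .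
    have "real (U i) * ln (real p) \<le> ln (real_of_int \<bar>coeff (P i) 0\<bar>)" unfolding U_def
      using c0[OF i] by (intro ln_le pq) auto
    also have "\<dots> \<le> log_mahler (x i)"
      using ln_coeff_0_le_log_mahler[OF alg[OF i]] by (simp add: P_def)
    finally have "real (U i) * ln (real p) \<le> log_mahler (x i)" .
    moreover have "real (w i) * ln (real p) \<le> real (w i) * ln (real q)"
      using lp by (intro mult_left_mono) auto
    moreover have "u i \<le> U i \<or> u i \<le> w i" using u i by (auto simp: max_def split: if_splits)
    then have "real (u i) * ln (real p) \<le> real (U i) * ln (real p) \<or>
        real (u i) * ln (real p) \<le> real (w i) * ln (real p)"
      using lp by (auto intro!: mult_right_mono)
    ultimately show "real (u i) * ln (real p) \<le> log_mahler (x i)" using q by linarith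
  qed
  then show ?thesis using u w by (intro exI[of _ u] exI[of _ w]) (auto simp: N_def x_def)
qed

section \<open>Primes with prescribed ratio of logarithms\<close>

lemma Leibniz_triangle:
  assumes "Suc k \<le> n"
  shows "1 / (real (Suc n) * real (n choose Suc k)) =
           1 / (real n * real ((n - 1) choose k)) - 1 / (real (Suc n) * real (n choose k))"
proof -
  obtain r where n: "n = Suc (k + r)" using assms by (metis less_eqE add_Suc)
  have 1: "real (n choose k) = fact n / (fact k * fact (Suc r))"
    using binomial_fact[of k n, where 'a = real] n by simp
  have 2: "real (n choose Suc k) = fact n / (fact (Suc k) * fact r)"
    using binomial_fact[of "Suc k" n, where 'a = real] n by simp
  have 3: "real ((n - 1) choose k) = fact (k + r) / (fact k * fact r)"
    using binomial_fact[of k "n - 1", where 'a = real] n by simp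
  have 4: "(fact n :: real) = real n * fact (k + r)"
    using n by simp
  have 5: "(fact (Suc r) :: real) = real (Suc r) * fact r" "(fact (Suc k) :: real) = real (Suc k) * fact k"
    by simp_all
  have "real n > 0" using n by simp
  moreover have "real (Suc k) = real (Suc n) - real (Suc r)" using n by simp
  ultimately show ?thesis
    unfolding 1 2 3 4 5 by (simp add: divide_simps del: of_nat_Suc) (simp add: algebra_simps del: of_nat_Suc)
qed

text \<open>The numbers 1 / ((n + 1) * (n choose k)) form Leibniz's harmonic triangle. Multiplied by
  \<open>D\<close> its border is integral, and each further diagonal consists of differences of
  entries of the one before.\<close>

lemma Suc_mult_binomial_dvd:
  fixes D N :: nat
  assumes D: "\<And>i. i \<in> {1..N} \<Longrightarrow> i dvd D" and "Suc n \<le> N" "k \<le> n"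
  shows "Suc n * (n choose k) dvd D"
proof -
  have "real D / (real (Suc n) * real (n choose k)) \<in> \<int>"
    using assms(2,3)
  proof (induction k arbitrary: n)
    case 0
    then have "Suc n dvd D" by (intro D) auto
    then obtain j where "D = Suc n * j" ..
    then have "real D / (real (Suc n) * real (n choose 0)) = real j"
      by (simp del: of_nat_Suc mult_Suc)
    then show ?case by simp
  next
    case (Suc k)
    have "real D / (real (Suc n) * real (n choose Suc k)) =
        real D / (real n * real ((n - 1) choose k)) - real D / (real (Suc n) * real (n choose k))"
      using arg_cong[OF Leibniz_triangle[OF Suc.prems(2)], of "\<lambda>x. real D * x"]
      by (simp add: right_diff_distrib)
    also have "\<dots> \<in> \<int>"
      using Suc.IH[of n] Suc.IH[of "n - 1"] Suc.prems by (intro Ints_diff) auto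
    finally show ?case .
  qed
  then obtain z where z: "real D / (real (Suc n) * real (n choose k)) = of_int z"
    by (elim Ints_cases)
  have "real (Suc n) * real (n choose k) > 0" using assms(3) by simp
  with z have "real_of_int (int D) = real_of_int (int (Suc n * (n choose k)) * z)"
    by (simp add: field_simps)
  then have "int D = int (Suc n * (n choose k)) * z" by (simp only: of_int_eq_iff)
  then show ?thesis by (metis dvd_triv_left int_dvd_int_iff)
qed

text \<open>
  For \<open>D\<close> the least common multiple of \<open>1, \<dots>, N\<close> one has \<open>2 ^ (N - 1) \<le> D\<close> by summing
  \<open>N * (N - 1 choose k) dvd D\<close> over \<open>k\<close>, and \<open>D \<le> N ^ \<pi>(N)\<close>.
\<close>

lemma power_2_le_power_of_primes_bound:
  fixes X N :: nat
  assumes N: "N \<ge> 1" and no: "\<And>p. prime p \<Longrightarrow> X < p \<Longrightarrow> p \<le> N \<Longrightarrow> False"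
  shows "2 ^ (N - 1) \<le> N ^ X"
proof -
  define A where "A = {p. prime p \<and> p \<le> N}"
  \<comment> \<open>The largest exponent with \<open>p ^ e p \<le> N\<close>, which makes
    \<open>D\<close> the least common multiple.\<close>
  define e where "e = (\<lambda>p. nat \<lfloor>log (real p) (real N)\<rfloor>)"
  define D where "D = (\<Prod>p\<in>A. p ^ e p)"
  have finA: "finite A" by (auto simp: A_def)
  \<comment> \<open>Without a prime in (X, N] there are at most \<open>X\<close> primes up to
    \<open>N\<close>; this turns the exponent \<pi>(N) into \<open>X\<close>.\<close>
  have "A \<subseteq> {1..X}"
  proof
    fix p assume "p \<in> A"
    then have "prime p" "p \<le> N" by (auto simp: A_def)
    then show "p \<in> {1..X}" using no[of p] prime_ge_1_nat[of p] by (cases "X < p") auto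
  qed
  then have cardA: "card A \<le> X" using card_mono[of "{1..X}" A] by simp
  have e_ge: "m \<le> e p" if "p \<in> A" "p ^ m \<le> N" for p m
  proof -
    have p: "real p > 1" using that prime_gt_1_nat by (auto simp: A_def)
    have "real p ^ m \<le> real N" using that(2) by (metis of_nat_le_iff of_nat_power)
    then have "real m \<le> log (real p) (real N)"
      using p N by (simp add: le_log_iff powr_realpow)
    then show ?thesis unfolding e_def by (simp add: le_nat_floor)
  qed
  have e_le: "p ^ e p \<le> N" if "p \<in> A" for p
  proof -
    have p: "real p > 1" using that prime_gt_1_nat by (auto simp: A_def)
    have "log (real p) (real N) \<ge> 0" using p N by simp
    then have "real (e p) \<le> log (real p) (real N)" unfolding e_def by simp
    then have "real p powr real (e p) \<le> real N" using p N by (simp add: le_log_iff)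
    then have "real (p ^ e p) \<le> real N" using p by (simp add: powr_realpow)
    then show ?thesis by (simp only: of_nat_le_iff)
  qed
  have dvd: "i dvd D" if i: "i \<in> {1..N}" for i
  proof -
    have "i = (\<Prod>p\<in>prime_factors i. p ^ multiplicity p i)"
      using i prime_factorization_nat[of i] by simp
    also have "\<dots> dvd D" unfolding D_def
    proof (rule prod_dvd_prod_subset2)
      show "prime_factors i \<subseteq> A"
        using i by (auto simp: A_def in_prime_factors_iff dest!: dvd_imp_le)
      fix p assume p: "p \<in> prime_factors i"
      have "p ^ multiplicity p i \<le> i" using i by (intro dvd_imp_le multiplicity_dvd) auto
      then have "multiplicity p i \<le> e p"
        using p i \<open>prime_factors i \<subseteq> A\<close> by (intro e_ge) auto
      then show "p ^ multiplicity p i dvd p ^ e p" by (rule le_imp_power_dvd)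
    qed (rule finA)
    finally show ?thesis .
  qed
  have "D > 0" using prime_gt_0_nat by (auto simp: D_def A_def intro!: prod_pos)
  have "N * 2 ^ (N - 1) = (\<Sum>k\<le>N - 1. N * (N - 1 choose k))"
    by (simp add: choose_row_sum sum_distrib_left[symmetric])
  also have "\<dots> \<le> (\<Sum>k\<le>N - 1. D)"
  proof (rule sum_mono)
    fix k assume "k \<in> {..N - 1}"
    then have "Suc (N - 1) * (N - 1 choose k) dvd D"
      using N by (intro Suc_mult_binomial_dvd[where N = N] dvd) auto
    then show "N * (N - 1 choose k) \<le> D" using N \<open>D > 0\<close> by (auto dest: dvd_imp_le)
  qed
  also have "\<dots> = N * D" using N by simp
  finally have "2 ^ (N - 1) \<le> D" using N by simp
  also have "D \<le> (\<Prod>p\<in>A. N)" unfolding D_def using e_le by (intro prod_mono) auto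
  also have "\<dots> = N ^ card A" by simp
  also have "\<dots> \<le> N ^ X" using cardA N by (intro power_increasing) auto
  finally show ?thesis .
qed

text \<open>With N the integer part of X^(1+\<epsilon>), a gap without primes would give (N - 1) log
  2 \<le> X log N, and X^(1+\<epsilon>) outgrows X log X.\<close>

lemma eventually_prime_between_powr:
  assumes "\<epsilon> > 0"
  shows "eventually (\<lambda>X :: nat. \<exists>q. prime q \<and> X < q \<and> real q \<le> real X powr (1 + \<epsilon>)) at_top"
proof -
  \<comment> \<open>The 2 pays for the rounding in \<open>N\<close> and for the exponent
    \<open>N - 1\<close>.\<close>
  have "eventually (\<lambda>x :: real. x * ((1 + \<epsilon>) * ln x) < (x powr (1 + \<epsilon>) - 2) * ln 2) at_top"
    using assms by real_asymp
  then have "eventually (\<lambda>X :: nat. real X * ((1 + \<epsilon>) * ln (real X)) <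
      (real X powr (1 + \<epsilon>) - 2) * ln 2) at_top"
    by (rule eventually_compose_filterlim[OF _ filterlim_real_sequentially])
  then show ?thesis
    using eventually_ge_at_top[of 1]
  proof eventually_elim
    case (elim X)
    define y where "y = real X powr (1 + \<epsilon>)"
    define N where "N = nat \<lfloor>y\<rfloor>"
    have "real X powr 0 \<le> y" unfolding y_def using assms elim by (intro powr_mono) auto
    then have y1: "y \<ge> 1" using elim by simp
    then have N: "N \<ge> 1" "real N \<le> y" "real N > y - 1"
      unfolding N_def by (auto simp: le_nat_floor)
    have "\<not> 2 ^ (N - 1) \<le> N ^ X"
    proof
      assume "2 ^ (N - 1) \<le> N ^ X"
      then have "real (2 ^ (N - 1)) \<le> real (N ^ X)" by (simp only: of_nat_le_iff)
      then have "ln (2 ^ (N - 1)) \<le> ln (real N ^ X)"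
        using N by (subst ln_le_cancel_iff) auto
      then have "real (N - 1) * ln 2 \<le> real X * ln (real N)"
        using N by (simp add: ln_realpow)
      also have "\<dots> \<le> real X * ln y" using N by (intro mult_left_mono) auto
      also have "ln y = (1 + \<epsilon>) * ln (real X)" using elim by (simp add: y_def ln_powr)
      also have "real X * \<dots> < (y - 2) * ln 2" using elim by (simp add: y_def)
      also have "\<dots> \<le> real (N - 1) * ln 2" using N by (intro mult_right_mono) auto
      finally show False by simp
    qed
    then obtain q where "prime q" "X < q" "q \<le> N"
      using power_2_le_power_of_primes_bound[OF N(1), of X] by blast
    moreover from this have "real q \<le> y" using N(2) by linarith
    ultimately show ?case unfolding y_def by blast
  qed
qed

text \<open>For every large prime p there is a prime q in (p^r, p^(r(1+\<epsilon>))], so the ratio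
  lies in (r, r(1+\<epsilon>)]. Distinct p give distinct pairs.\<close>

lemma infinite_prime_pairs_log_ratio:
  fixes r \<delta> :: real
  assumes r: "r \<ge> 1" and \<delta>: "\<delta> > 0"
  shows "infinite {(p :: nat, q :: nat). prime p \<and> prime q \<and> p < q \<and> \<bar>ln (real q) / ln (real p) - r\<bar> < \<delta>}"
proof
  let ?S = "{(p :: nat, q :: nat). prime p \<and> prime q \<and> p < q \<and> \<bar>ln (real q) / ln (real p) - r\<bar> < \<delta>}"
  assume fin: "finite ?S"
  define \<epsilon> where "\<epsilon> = \<delta> / (2 * r)"
  have \<epsilon>: "\<epsilon> > 0" "r * \<epsilon> < \<delta>" using r \<delta> by (auto simp: \<epsilon>_def)
  have "filterlim (\<lambda>p :: nat. nat \<lfloor>real p powr r\<rfloor>) at_top at_top"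
    using r by real_asymp
  from eventually_compose_filterlim[OF eventually_prime_between_powr[OF \<epsilon>(1)] this]
  obtain M where M: "\<And>p. p \<ge> M \<Longrightarrow> \<exists>q. prime q \<and> nat \<lfloor>real p powr r\<rfloor> < q \<and>
      real q \<le> real (nat \<lfloor>real p powr r\<rfloor>) powr (1 + \<epsilon>)"
    unfolding eventually_at_top_linorder by blast
  have "{p. prime p \<and> p \<ge> M} \<subseteq> fst ` ?S"
  proof
    fix p assume "p \<in> {p. prime p \<and> p \<ge> M}"
    then have p: "prime p" "p \<ge> M" by auto
    have p1: "real p > 1" using prime_gt_1_nat[OF p(1)] by simp
    obtain q where q: "prime q" "nat \<lfloor>real p powr r\<rfloor> < q"
        "real q \<le> real (nat \<lfloor>real p powr r\<rfloor>) powr (1 + \<epsilon>)" using M[OF p(2)] by blast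
    have "\<lfloor>real p powr r\<rfloor> < int q" using q(2) by linarith
    then have gt: "real p powr r < real q" by linarith
    have "real p powr 1 \<le> real p powr r" using p1 r by (intro powr_mono) auto
    then have pq: "p < q" using gt p1 by simp
    note q(3)
    also have "real (nat \<lfloor>real p powr r\<rfloor>) powr (1 + \<epsilon>) \<le> (real p powr r) powr (1 + \<epsilon>)"
      using \<epsilon> by (intro powr_mono2) auto
    finally have le: "real q \<le> (real p powr r) powr (1 + \<epsilon>)" .
    have q0: "real q > 0" using q(1) prime_gt_0_nat by auto
    have "ln (real p powr r) < ln (real q)"
      using gt p1 q0 by (subst ln_less_cancel_iff) auto
    then have "r * ln (real p) < ln (real q)" using p1 by (simp add: ln_powr)
    moreover have "ln (real q) \<le> ln ((real p powr r) powr (1 + \<epsilon>))"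
      using le p1 q0 by (subst ln_le_cancel_iff) auto
    then have "ln (real q) \<le> r * (1 + \<epsilon>) * ln (real p)" using p1 by (simp add: ln_powr powr_powr)
    moreover have "ln (real p) > 0" using p1 by simp
    ultimately have "r < ln (real q) / ln (real p)" "ln (real q) / ln (real p) \<le> r * (1 + \<epsilon>)"
      by (simp_all add: field_simps)
    then have "\<bar>ln (real q) / ln (real p) - r\<bar> < \<delta>" using \<epsilon>(2) by (simp add: algebra_simps)
    then show "p \<in> fst ` ?S" using p q pq by (intro image_eqI[of _ _ "(p, q)"]) auto
  qed
  then have "finite {p. prime p \<and> p \<ge> M}" using fin by (meson finite_imageI finite_subset)
  moreover have "{p :: nat. prime p} \<subseteq> {p. prime p \<and> p \<ge> M} \<union> {..<M}" by auto
  ultimately have "finite {p :: nat. prime p}" by (meson finite_Un finite_lessThan finite_subset)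
  then show False using primes_infinite by simp
qed

section \<open>Exceptional points\<close>

lemma sum_yvec_fib:
  assumes "1 \<le> k" "k < l" "l \<le> n" "odd (l - k)"
  shows "(\<Sum>i=1..n. yvec n k l i * real (fib i)) = real (fib n)"
    and "(\<Sum>i=1..n. yvec n k l i * real (fib (i - 1))) = real (fib (n - 1))"
proof -
  have pos: "real (fib (l - k)) > 0" using assms fib_neq_0_nat[of "l - k"] by simp
  show "(\<Sum>i=1..n. yvec n k l i * real (fib i)) = real (fib n)"
    unfolding sum_yvec[OF assms] using fib_opposite_parity'[OF assms] pos by (simp add: field_simps)
  \<comment> \<open>The same identity with \<open>k\<close>, \<open>l\<close> and \<open>n\<close>
    lowered by one, which leaves their differences unchanged.\<close>
  have "fib (l - k) * fib (k - 1 + (l - k) + (n - l)) =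
      fib (n - l) * fib (k - 1) + fib (l - k + (n - l)) * fib (k - 1 + (l - k))"
    using assms by (intro fib_opposite_parity) auto
  moreover have "k - 1 + (l - k) + (n - l) = n - 1" "l - k + (n - l) = n - k" "k - 1 + (l - k) = l - 1"
    using assms by auto
  ultimately have "fib (l - k) * fib (n - 1) = fib (n - l) * fib (k - 1) + fib (n - k) * fib (l - 1)"
    by simp
  then have "real (fib (l - k)) * real (fib (n - 1)) =
      real (fib (n - l)) * real (fib (k - 1)) + real (fib (n - k)) * real (fib (l - 1))"
    by (metis of_nat_add of_nat_mult)
  then show "(\<Sum>i=1..n. yvec n k l i * real (fib (i - 1))) = real (fib (n - 1))"
    unfolding sum_yvec[OF assms] using pos by (simp add: field_simps)
qed

lemma Fplus_nonneg:
  assumes "y \<in> Fplus n"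
  shows "y i \<ge> 0"
proof -
  obtain k l where "y = yvec n k l" "odd (l - k)" using assms by (auto simp: Fplus_def)
  moreover from this(2) have "even (l - k + 1)" by simp
  then have "(- 1 :: real) ^ (l - k + 1) = 1" by (rule neg_one_even_power)
  ultimately show ?thesis by (simp add: yvec_def)
qed

lemma Fplus_sum_fib:
  assumes "y \<in> Fplus n"
  shows "(\<Sum>i=1..n. y i * real (fib i)) = real (fib n)"
    "(\<Sum>i=1..n. y i * real (fib (i - 1))) = real (fib (n - 1))"
  using assms sum_yvec_fib unfolding Fplus_def by blast+

lemma finite_Fplus: "finite (Fplus n)"
proof (rule finite_subset)
  show "Fplus n \<subseteq> (\<lambda>(k, l). yvec n k l) ` ({1..n} \<times> {1..n})"
    unfolding Fplus_def by force
qed auto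

section \<open>Factorizations that attain the metric Mahler measure\<close>

lemma tuple_measure_powr:
  assumes "s > 0"
  shows "tuple_measure s xs powr s = (\<Sum>x\<leftarrow>xs. log_mahler x powr s)"
proof -
  have "0 \<le> (\<Sum>x\<leftarrow>xs. log_mahler x powr s)" by (intro sum_list_nonneg) auto
  then show ?thesis using assms by (simp add: tuple_measure_def powr_powr)
qed

lemma tuple_measure_le_iff:
  assumes "s > 0"
  shows "tuple_measure s xs \<le> tuple_measure s ys \<longleftrightarrow>
    (\<Sum>x\<leftarrow>xs. log_mahler x powr s) \<le> (\<Sum>x\<leftarrow>ys. log_mahler x powr s)"
proof
  assume "tuple_measure s xs \<le> tuple_measure s ys"
  then have "tuple_measure s xs powr s \<le> tuple_measure s ys powr s"
    using assms by (intro powr_mono2) (auto simp: tuple_measure_def)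
  then show "(\<Sum>x\<leftarrow>xs. log_mahler x powr s) \<le> (\<Sum>x\<leftarrow>ys. log_mahler x powr s)"
    using assms by (simp add: tuple_measure_powr)
next
  assume "(\<Sum>x\<leftarrow>xs. log_mahler x powr s) \<le> (\<Sum>x\<leftarrow>ys. log_mahler x powr s)"
  then show "tuple_measure s xs \<le> tuple_measure s ys"
    unfolding tuple_measure_def using assms by (intro powr_mono2 sum_list_nonneg) auto
qed

lemma metric_mahler_le:
  assumes "xs \<in> factorizations \<alpha>"
  shows "metric_mahler s \<alpha> \<le> tuple_measure s xs"
  unfolding metric_mahler_def using assms
  by (intro cINF_lower bdd_belowI2[of _ 0]) (auto simp: tuple_measure_def)

lemma metric_mahler_eqI:
  assumes "xs \<in> factorizations \<alpha>" "s > 0"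
    and "\<And>ys. ys \<in> factorizations \<alpha> \<Longrightarrow>
           (\<Sum>x\<leftarrow>xs. log_mahler x powr s) \<le> (\<Sum>x\<leftarrow>ys. log_mahler x powr s)"
  shows "metric_mahler s \<alpha> = tuple_measure s xs"
proof (rule antisym)
  show "tuple_measure s xs \<le> metric_mahler s \<alpha>"
    unfolding metric_mahler_def using assms
    by (intro cINF_greatest) (auto simp: tuple_measure_le_iff)
qed (use metric_mahler_le assms in auto)

lemma not_exceptional_point_imp:
  assumes "\<not> exceptional_point \<alpha> t" "t > 0"
  shows "\<exists>xs\<in>factorizations \<alpha>. eventually (\<lambda>s. metric_mahler s \<alpha> = tuple_measure s xs) (nhds t)"
proof -
  obtain U xs where U: "t \<in> interior U" "xs \<in> factorizations \<alpha>"
      "\<And>s. s \<in> U \<Longrightarrow> \<not> metric_mahler s \<alpha> < tuple_measure s xs"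
    using assms unfolding exceptional_point_def by blast
  have "metric_mahler s \<alpha> = tuple_measure s xs" if "s \<in> interior U" for s
    using U(3)[of s] metric_mahler_le[OF U(2), of s] that interior_subset by force
  then have "eventually (\<lambda>s. metric_mahler s \<alpha> = tuple_measure s xs) (nhds t)"
    using U(1) eventually_nhds open_interior by blast
  then show ?thesis using U(2) by blast
qed

lemma eventually_nhds_gt:
  fixes a t :: "'a :: order_topology"
  assumes "a < t"
  shows "eventually (\<lambda>s. a < s) (nhds t)"
  using assms by (rule order_tendstoD(1)[OF filterlim_ident])

text \<open>The entire extension of a sum of real powers. Zero bases are treated apart because
  \<open>0 powr s = 0\<close>.\<close>

definition exp_sum :: "real list \<Rightarrow> complex \<Rightarrow> complex" where
  "exp_sum as z = (\<Sum>a\<leftarrow>as. if a = 0 then 0 else exp (z * of_real (ln a)))"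

lemma exp_sum_of_real: "exp_sum as (of_real s) = of_real (\<Sum>a\<leftarrow>as. a powr s)"
  unfolding exp_sum_def powr_def by (induction as) (auto simp flip: exp_of_real)

lemma exp_sum_holomorphic: "exp_sum as holomorphic_on UNIV"
  unfolding exp_sum_def
proof (induction as)
  case (Cons a as)
  have "(\<lambda>z. if a = 0 then 0 else exp (z * of_real (ln a))) holomorphic_on UNIV"
    by (cases "a = 0") (auto intro!: holomorphic_intros)
  then show ?case using Cons by (auto intro!: holomorphic_intros)
qed simp

text \<open>The difference of the entire extensions vanishes on a real interval, so the identity
  theorem applies; no linear independence of exponentials is required.\<close>

lemma powr_sum_eq_everywhere:
  fixes as bs :: "real list"
  assumes "eventually (\<lambda>s. (\<Sum>a\<leftarrow>as. a powr s) = (\<Sum>b\<leftarrow>bs. b powr s)) (nhds t)"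
  shows "(\<Sum>a\<leftarrow>as. a powr s) = (\<Sum>b\<leftarrow>bs. b powr s)"
proof -
  obtain S where S: "open S" "t \<in> S" "\<And>s. s \<in> S \<Longrightarrow> (\<Sum>a\<leftarrow>as. a powr s) = (\<Sum>b\<leftarrow>bs. b powr s)"
    using assms unfolding eventually_nhds by blast
  have lim: "of_real t islimpt (of_real ` S :: complex set)"
    unfolding islimpt_approachable
  proof (intro allI impI)
    fix e :: real assume "e > 0"
    have "t islimpt S" using S by (simp add: interior_limit_point interior_open)
    then obtain r where r: "r \<in> S" "r \<noteq> t" "dist r t < e"
      using \<open>e > 0\<close> unfolding islimpt_approachable by blast
    then show "\<exists>x'\<in>of_real ` S. x' \<noteq> (of_real t :: complex) \<and> dist x' (of_real t) < e"
      by (intro bexI[of _ "of_real r"]) (auto simp: dist_of_real)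
  qed
  have "exp_sum as (of_real s) - exp_sum bs (of_real s) = 0"
  proof (rule analytic_continuation[where f = "\<lambda>z. exp_sum as z - exp_sum bs z" and S = UNIV and U = "of_real ` S" and \<xi> = "of_real t"])
    show "(\<lambda>z. exp_sum as z - exp_sum bs z) holomorphic_on UNIV"
      by (intro holomorphic_intros exp_sum_holomorphic)
  qed (use lim S in \<open>auto simp: exp_sum_of_real\<close>)
  then have "(of_real (\<Sum>a\<leftarrow>as. a powr s) :: complex) = of_real (\<Sum>b\<leftarrow>bs. b powr s)"
    by (simp add: exp_sum_of_real)
  then show ?thesis by (simp only: of_real_eq_iff)
qed

lemma tuple_measure_eq_everywhere:
  assumes ev: "eventually (\<lambda>s. tuple_measure s xs = tuple_measure s ys) (nhds t)" and "t > 0" "s > 0"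
  shows "tuple_measure s xs = tuple_measure s ys"
proof -
  have "eventually (\<lambda>s. s > 0) (nhds t)" using \<open>t > 0\<close> by (rule eventually_nhds_gt)
  with ev have "eventually (\<lambda>s. (\<Sum>a\<leftarrow>map log_mahler xs. a powr s) = (\<Sum>a\<leftarrow>map log_mahler ys. a powr s)) (nhds t)"
  proof eventually_elim
    case (elim s)
    then show ?case using tuple_measure_powr[of s xs] tuple_measure_powr[of s ys] by (simp add: o_def)
  qed
  from powr_sum_eq_everywhere[OF this, of s] show ?thesis by (simp add: tuple_measure_def o_def)
qed

text \<open>
  Without exceptional points the optimal sum of exponentials is locally constant, as two such
  sums that agree on an open interval coincide.
\<close>

lemma exceptional_point_between:
  assumes ab: "0 < a" "a < b"
    and xs: "eventually (\<lambda>s. metric_mahler s \<alpha> = tuple_measure s xs) (nhds a)" "xs \<in> factorizations \<alpha>"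
    and ys: "eventually (\<lambda>s. metric_mahler s \<alpha> = tuple_measure s ys) (nhds b)" "ys \<in> factorizations \<alpha>"
    and neq: "tuple_measure b xs \<noteq> tuple_measure b ys"
  shows "\<exists>s. a < s \<and> s < b \<and> exceptional_point \<alpha> s"
proof (rule ccontr)
  assume no: "\<not> ?thesis"
  \<comment> \<open>A truth-valued function on the connected interval from \<open>a\<close> to
    \<open>b\<close>. It is shown to be locally constant, so optimality of \<open>xs\<close> spreads
    from \<open>a\<close> to \<open>b\<close>.\<close>
  define f where "f = (\<lambda>s. eventually (\<lambda>r. metric_mahler r \<alpha> = tuple_measure r xs) (nhds s))"
  have "f a = f b"
  proof (rule connected_local_const[where A = "{a..b}"])
    show "\<forall>s\<in>{a..b}. eventually (\<lambda>r. f s = f r) (at s within {a..b})"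
    proof
      fix s assume s: "s \<in> {a..b}"
      then have s0: "s > 0" using ab by simp
      have "\<exists>zs. eventually (\<lambda>r. metric_mahler r \<alpha> = tuple_measure r zs) (nhds s)"
      proof (cases "s = a \<or> s = b")
        case True
        then show ?thesis using xs ys by blast
      next
        case False
        then have "\<not> exceptional_point \<alpha> s" using no s by auto
        then show ?thesis using not_exceptional_point_imp s0 by blast
      qed
      then obtain zs where zs: "eventually (\<lambda>r. metric_mahler r \<alpha> = tuple_measure r zs) (nhds s)" ..
      \<comment> \<open>Where \<open>zs\<close> is locally optimal, \<open>f r\<close> amounts to a
        condition that does not mention \<open>r\<close>.\<close>
      have f_iff: "f r \<longleftrightarrow> (\<forall>x>0. tuple_measure x zs = tuple_measure x xs)"
        if r: "r > 0" "eventually (\<lambda>r. metric_mahler r \<alpha> = tuple_measure r zs) (nhds r)" for r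
      proof
        assume "f r"
        then have "eventually (\<lambda>x. tuple_measure x zs = tuple_measure x xs) (nhds r)"
          using r(2) unfolding f_def by eventually_elim simp
        then show "\<forall>x>0. tuple_measure x zs = tuple_measure x xs"
          using tuple_measure_eq_everywhere r(1) by blast
      next
        assume eq: "\<forall>x>0. tuple_measure x zs = tuple_measure x xs"
        have "eventually (\<lambda>x. x > 0) (nhds r)" using r(1) by (rule eventually_nhds_gt)
        with r(2) show "f r" unfolding f_def by eventually_elim (use eq in auto)
      qed
      have "eventually (\<lambda>r. r > 0 \<and> eventually (\<lambda>r. metric_mahler r \<alpha> = tuple_measure r zs) (nhds r)) (nhds s)"
        using zs s0 by (intro eventually_conj eventually_nhds_gt) (simp_all add: eventually_eventually)
      then have "eventually (\<lambda>r. f s = f r) (nhds s)"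
        by eventually_elim (use f_iff zs s0 in auto)
      then show "eventually (\<lambda>r. f s = f r) (at s within {a..b})"
        by (metis eventually_nhds_conv_at filter_leD at_within_le_nhds)
    qed
  qed (use ab in auto)
  moreover have "f a" using xs by (simp add: f_def)
  ultimately have "f b" by simp
  then have "metric_mahler b \<alpha> = tuple_measure b xs"
    unfolding f_def by (rule eventually_nhds_x_imp_x)
  moreover have "metric_mahler b \<alpha> = tuple_measure b ys"
    using ys(1) by (rule eventually_nhds_x_imp_x)
  ultimately show False using neq by simp
qed

section \<open>Bounds and optimal factorizations for the quotient of prime powers\<close>

lemma max_log_eq:
  assumes "p > 1"
  shows "max (a * ln (real p)) (b * ln (real q)) = ln (real p) * max a (ln (real q) / ln (real p) * b)"
proof -
  have l: "ln (real p) > 0" using assms by simp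
  then have "ln (real p) * max a (ln (real q) / ln (real p) * b) =
      max (ln (real p) * a) (ln (real p) * (ln (real q) / ln (real p) * b))"
    by (simp add: max_mult_distrib_left)
  then show ?thesis using l by (simp add: mult.commute)
qed

lemma factorization_lower_bound:
  assumes pq: "prime p" "prime q" "p < q" and n: "n \<ge> 3" and \<theta>: "\<theta> = ln (real q) / ln (real p)"
    and good: "good_ratio n \<theta>" and s: "s > 0"
    and m: "\<And>y. y \<in> Fplus n \<Longrightarrow> m \<le> (\<Sum>i=1..n. y i * fib_height \<theta> i powr s)"
    and xs: "xs \<in> factorizations (of_nat p ^ fib n / of_nat q ^ fib (n - 1))"
  shows "ln (real p) powr s * m \<le> (\<Sum>x\<leftarrow>xs. log_mahler x powr s)"
proof -
  define N where "N = length xs"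
  have p1: "p > 1" using prime_gt_1_nat[OF pq(1)] .
  have "fib (n - 1) \<le> fib n" by (intro fib_mono) simp
  from factorization_exponents[OF pq this xs] obtain u w where
    uw: "(\<Sum>i<N. u i) = fib n" "(\<Sum>i<N. w i) = fib (n - 1)" and le: "\<And>i. i < N \<Longrightarrow> w i \<le> u i"
    and h: "\<And>i. i < N \<Longrightarrow> max (real (u i) * ln (real p)) (real (w i) * ln (real q)) \<le> log_mahler (xs ! i)"
    unfolding N_def by blast
  define ps where "ps = map (\<lambda>i. (u i, w i)) [0..<N]"
  have "m \<le> (\<Sum>p\<leftarrow>ps. max (real (fst p)) (\<theta> * real (snd p)) powr s)"
  proof (rule lattice_partition_lower_bound[OF n good s m])
    show "\<forall>p\<in>set ps. snd p \<le> fst p" using le by (auto simp: ps_def)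
    show "sum_list (map fst ps) = fib n" "sum_list (map snd ps) = fib (n - 1)"
      using uw by (simp_all add: ps_def o_def interv_sum_list_conv_sum_set_nat atLeast0LessThan)
  qed
  also have "\<dots> = (\<Sum>i<N. max (real (u i)) (\<theta> * real (w i)) powr s)"
    by (simp add: ps_def o_def interv_sum_list_conv_sum_set_nat atLeast0LessThan)
  finally have "ln (real p) powr s * m \<le> ln (real p) powr s * (\<Sum>i<N. max (real (u i)) (\<theta> * real (w i)) powr s)"
    by (intro mult_left_mono) auto
  also have "\<dots> = (\<Sum>i<N. max (real (u i) * ln (real p)) (real (w i) * ln (real q)) powr s)"
    unfolding max_log_eq[OF p1] \<theta>[symmetric] sum_distrib_left
    by (intro sum.cong refl powr_mult[symmetric])
  also have "\<dots> \<le> (\<Sum>i<N. log_mahler (xs ! i) powr s)"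
    using h s p1 prime_gt_1_nat[OF pq(2)] by (intro sum_mono powr_mono2) (auto simp: le_max_iff_disj)
  also have "\<dots> = (\<Sum>x\<leftarrow>xs. log_mahler x powr s)"
    by (simp add: sum.list_conv_set_nth atLeast0LessThan N_def)
  finally show ?thesis .
qed

lemma sum_list_concat_replicate:
  fixes f :: "'a \<Rightarrow> real"
  shows "(\<Sum>x\<leftarrow>concat (map (\<lambda>i. replicate (c i) (b i)) is). f x) = (\<Sum>i\<leftarrow>is. real (c i) * f (b i))"
  by (induction "is") (auto simp: sum_list_replicate)

text \<open>Integrality enters here: \<open>y i\<close> copies of p^(f_i) / q^(f_(i-1)) are taken,
  and the two equations satisfied by \<open>y\<close> give the product. The same tuple serves for
  all \<open>s\<close>.\<close>

lemma Fplus_factorization: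
  assumes pq: "prime p" "prime q" "p < q" and n: "n \<ge> 3" and \<theta>: "\<theta> = ln (real q) / ln (real p)"
    and y: "y \<in> Fplus n" and int: "\<forall>j\<in>{1..n}. y j \<in> \<int>"
  shows "\<exists>xs\<in>factorizations (of_nat p ^ fib n / of_nat q ^ fib (n - 1)).
           \<forall>s. (\<Sum>x\<leftarrow>xs. log_mahler x powr s) =
                 ln (real p) powr s * (\<Sum>i=1..n. y i * fib_height \<theta> i powr s)"
proof -
  have p1: "p > 1" "q > 1" using prime_gt_1_nat pq by auto
  define c where "c = (\<lambda>i. nat \<lfloor>y i\<rfloor>)"
  have c: "real (c i) = y i" if "i \<in> {1..n}" for i
    using int that Fplus_nonneg[OF y, of i] by (auto simp: c_def elim!: Ints_cases)
  define \<beta> where "\<beta> = (\<lambda>i. of_nat (p ^ fib i) / of_nat (q ^ fib (i - 1)) :: complex)"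
  define xs where "xs = concat (map (\<lambda>i. replicate (c i) (\<beta> i)) [1..<Suc n])"
  have conv: "(\<Sum>i\<leftarrow>[1..<Suc n]. f i) = (\<Sum>i=1..n. f i)" for f :: "nat \<Rightarrow> real"
    by (simp add: interv_sum_list_conv_sum_set_nat atLeastLessThanSuc_atLeastAtMost del: upt_Suc)
  have u: "(\<Sum>i=1..n. c i * fib i) = fib n"
  proof -
    have "real (\<Sum>i=1..n. c i * fib i) = (\<Sum>i=1..n. y i * real (fib i))"
      using c by simp
    then show ?thesis unfolding Fplus_sum_fib(1)[OF y] by (simp only: of_nat_eq_iff)
  qed
  have w: "(\<Sum>i=1..n. c i * fib (i - 1)) = fib (n - 1)"
  proof -
    have "real (\<Sum>i=1..n. c i * fib (i - 1)) = (\<Sum>i=1..n. y i * real (fib (i - 1)))"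
      using c by simp
    then show ?thesis unfolding Fplus_sum_fib(2)[OF y] by (simp only: of_nat_eq_iff)
  qed
  have "prod_list (concat (map (\<lambda>i. replicate (c i) (\<beta> i)) is)) = (\<Prod>i\<leftarrow>is. \<beta> i ^ c i)" for "is"
    by (induction "is") auto
  then have "prod_list xs = (\<Prod>i\<leftarrow>[1..<Suc n]. \<beta> i ^ c i)" unfolding xs_def .
  also have "\<dots> = (\<Prod>i=1..n. \<beta> i ^ c i)"
    by (subst prod.distinct_set_conv_list[symmetric]) (auto simp: atLeastLessThanSuc_atLeastAtMost simp del: upt_Suc)
  also have "\<dots> = (\<Prod>i=1..n. of_nat p ^ (c i * fib i) / of_nat q ^ (c i * fib (i - 1)))"
    by (intro prod.cong) (auto simp: \<beta>_def power_divide power_mult[symmetric] mult.commute)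
  also have "\<dots> = of_nat p ^ fib n / of_nat q ^ fib (n - 1)"
    unfolding prod_dividef power_sum[symmetric] u w ..
  finally have prod: "prod_list xs = of_nat p ^ fib n / of_nat q ^ fib (n - 1)" .
  have "xs \<noteq> []"
  proof
    assume "xs = []"
    then have "c i = 0" if "i \<in> {1..n}" for i using that by (auto simp: xs_def simp del: upt_Suc)
    then have "fib n = 0" using u by simp
    then show False using n fib_neq_0_nat[of n] by simp
  qed
  moreover have "algebraic x \<and> x \<noteq> 0" if x: "x \<in> set xs" for x
  proof -
    obtain i where "x = \<beta> i" using x by (auto simp: xs_def simp del: upt_Suc)
    then show ?thesis using p1 by (auto simp: \<beta>_def intro!: rat_imp_algebraic)
  qed
  ultimately have "xs \<in> factorizations (of_nat p ^ fib n / of_nat q ^ fib (n - 1))"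
    using prod by (auto simp: factorizations_def)
  moreover have "(\<Sum>x\<leftarrow>xs. log_mahler x powr s) =
      ln (real p) powr s * (\<Sum>i=1..n. y i * fib_height \<theta> i powr s)" for s
  proof -
    have m: "log_mahler (\<beta> i) = ln (real p) * fib_height \<theta> i" for i
    proof -
      have "log_mahler (\<beta> i) = max (ln (real (p ^ fib i))) (ln (real (q ^ fib (i - 1))))"
        unfolding \<beta>_def using pq p1 by (intro log_mahler_quotient) (auto simp: primes_coprime)
      also have "\<dots> = max (real (fib i) * ln (real p)) (real (fib (i - 1)) * ln (real q))"
        using p1 by (simp add: ln_realpow)
      finally show ?thesis unfolding max_log_eq[OF p1(1)] \<theta> fib_height_def .
    qed
    have "(\<Sum>x\<leftarrow>xs. log_mahler x powr s) = (\<Sum>i=1..n. real (c i) * log_mahler (\<beta> i) powr s)"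
      unfolding xs_def sum_list_concat_replicate conv ..
    also have "\<dots> = (\<Sum>i=1..n. ln (real p) powr s * (y i * fib_height \<theta> i powr s))"
    proof (intro sum.cong refl)
      fix i assume "i \<in> {1..n}"
      then have "real (c i) = y i" by (rule c)
      moreover have "fib_height \<theta> i \<ge> 0" by (simp add: fib_height_def le_max_iff_disj)
      ultimately show "real (c i) * log_mahler (\<beta> i) powr s = ln (real p) powr s * (y i * fib_height \<theta> i powr s)"
        unfolding m using p1 by (simp add: powr_mult)
    qed
    finally show ?thesis by (simp add: sum_distrib_left)
  qed
  ultimately show ?thesis by blast
qed

section \<open>Stability of the strict inequalities near the golden ratio\<close>

lemma eventually_good_ratio: "eventually (good_ratio n) (nhds golden_ratio)"
proof -
  have "eventually (\<lambda>\<theta>. if odd j then \<theta> * real (fib (j - 1)) \<le> real (fib j)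
                 else real (fib j) \<le> \<theta> * real (fib (j - 1))) (nhds golden_ratio)"
    if j: "j \<in> {1..n}" for j
  proof -
    have lim: "((\<lambda>\<theta>. \<theta> * real (fib (j - 1))) \<longlongrightarrow> golden_ratio * real (fib (j - 1))) (nhds golden_ratio)"
      by (intro tendsto_intros filterlim_ident)
    show ?thesis
    proof (cases "odd j")
      case True
      from order_tendstoD(2)[OF lim fib_gt_golden_ratio_mult[OF True]]
      show ?thesis by eventually_elim (use True in simp)
    next
      case False
      then have "real (fib j) < golden_ratio * real (fib (j - 1))"
        using j by (intro fib_less_golden_ratio_mult) auto
      from order_tendstoD(1)[OF lim this]
      show ?thesis by eventually_elim (use False in simp)
    qed
  qed
  then have "eventually (\<lambda>\<theta>. \<forall>j\<in>{1..n}. if odd j then \<theta> * real (fib (j - 1)) \<le> real (fib j)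
                 else real (fib j) \<le> \<theta> * real (fib (j - 1))) (nhds golden_ratio)"
    by (intro eventually_ball_finite) auto
  moreover have "eventually (\<lambda>\<theta>. \<theta> > 1) (nhds golden_ratio)"
    using golden_ratio_gt_1 by (rule eventually_nhds_gt)
  ultimately show ?thesis
    by eventually_elim (simp add: good_ratio_def)
qed

text \<open>The sums are jointly continuous in (\<theta>, s) at (\<open>golden_ratio\<close>,
  \<open>t\<close>), where they equal \<open>Gfun\<close>, and only finitely many strict
  inequalities have to be kept.\<close>

lemma eventually_unique_minimum:
  assumes "\<And>y. y \<in> Fplus n \<Longrightarrow> y \<noteq> z \<Longrightarrow> Gfun n z t < Gfun n y t"
  shows "eventually (\<lambda>\<theta>. eventually (\<lambda>s. \<forall>y\<in>Fplus n. y \<noteq> z \<longrightarrow>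
           (\<Sum>i=1..n. z i * fib_height \<theta> i powr s) < (\<Sum>i=1..n. y i * fib_height \<theta> i powr s)) (nhds t))
         (nhds golden_ratio)"
proof -
  have lim: "((\<lambda>x. \<Sum>i=1..n. y i * fib_height (fst x) i powr snd x) \<longlongrightarrow> Gfun n y t) (nhds (golden_ratio, t))"
    for y :: "nat \<Rightarrow> real"
    unfolding Gfun_def fib_height_def
  proof (intro tendsto_sum tendsto_mult tendsto_const tendsto_powr tendsto_max)
    show "(fst \<longlongrightarrow> golden_ratio) (nhds (golden_ratio, t))"
      using tendsto_fst[OF filterlim_ident, of "(golden_ratio, t)"] by simp
    show "(snd \<longlongrightarrow> t) (nhds (golden_ratio, t))"
      using tendsto_snd[OF filterlim_ident, of "(golden_ratio, t)"] by simp
    fix i assume "i \<in> {1..n}"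
    then have "fib i > 0" using fib_neq_0_nat[of i] by simp
    then show "max (real (fib i)) (golden_ratio * real (fib (i - 1))) \<noteq> 0" by linarith
  qed
  have "eventually (\<lambda>x. y \<noteq> z \<longrightarrow> (\<Sum>i=1..n. z i * fib_height (fst x) i powr snd x) <
      (\<Sum>i=1..n. y i * fib_height (fst x) i powr snd x)) (nhds (golden_ratio, t))"
    if "y \<in> Fplus n" for y
  proof (cases "y = z")
    case False
    have "eventually (\<lambda>x. (\<Sum>i=1..n. y i * fib_height (fst x) i powr snd x) -
        (\<Sum>i=1..n. z i * fib_height (fst x) i powr snd x) > 0) (nhds (golden_ratio, t))"
      using assms[OF that False] by (intro order_tendstoD(1)[OF tendsto_diff[OF lim lim]]) simp
    then show ?thesis by eventually_elim simp
  qed simp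
  then have "eventually (\<lambda>x. \<forall>y\<in>Fplus n. y \<noteq> z \<longrightarrow> (\<Sum>i=1..n. z i * fib_height (fst x) i powr snd x) <
      (\<Sum>i=1..n. y i * fib_height (fst x) i powr snd x)) (nhds golden_ratio \<times>\<^sub>F nhds t)"
    unfolding nhds_prod[symmetric] using finite_Fplus by (intro eventually_ball_finite) auto
  then obtain P Q where "eventually P (nhds golden_ratio)" and Q: "eventually Q (nhds t)"
    and PQ: "\<And>\<theta> s. P \<theta> \<Longrightarrow> Q s \<Longrightarrow> \<forall>y\<in>Fplus n. y \<noteq> z \<longrightarrow>
      (\<Sum>i=1..n. z i * fib_height \<theta> i powr s) < (\<Sum>i=1..n. y i * fib_height \<theta> i powr s)"
    unfolding eventually_prod_filter by auto
  from this(1) show ?thesis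
    by eventually_elim (use Q PQ in \<open>auto elim!: eventually_mono\<close>)
qed

lemma exceptional_points_of_quotient:
  fixes t :: "nat \<Rightarrow> real" and z :: "nat \<Rightarrow> nat \<Rightarrow> real"
  assumes pq: "prime p" "prime q" "p < q" and n: "n \<ge> 3" and \<theta>: "\<theta> = ln (real q) / ln (real p)"
    and good: "good_ratio n \<theta>"
    and t0: "\<And>i. i \<in> {1..n-1} \<Longrightarrow> t i > 0"
    and dec: "\<And>i. i \<in> {1..n-2} \<Longrightarrow> t (i + 1) < t i"
    and z: "\<And>i. i \<in> {1..n-1} \<Longrightarrow> z i \<in> Fplus n"
    and int: "\<And>i. i \<in> {1..n-1} \<Longrightarrow> \<forall>j\<in>{1..n}. z i j \<in> \<int>"
    and neq: "\<And>i. i \<in> {1..n-2} \<Longrightarrow> z i \<noteq> z (i + 1)"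
    and min: "\<And>i. i \<in> {1..n-1} \<Longrightarrow> eventually (\<lambda>s. \<forall>y\<in>Fplus n. y \<noteq> z i \<longrightarrow>
           (\<Sum>j=1..n. z i j * fib_height \<theta> j powr s) < (\<Sum>j=1..n. y j * fib_height \<theta> j powr s)) (nhds (t i))"
  shows "\<exists>T. T \<subseteq> {s. exceptional_point (of_nat p ^ fib n / of_nat q ^ fib (n - 1)) s} \<and>
           finite T \<and> card T \<ge> n - 2"
proof -
  define \<alpha> where "\<alpha> = (of_nat p ^ fib n / of_nat q ^ fib (n - 1) :: complex)"
  define G where "G = (\<lambda>y s. \<Sum>j=1..n. y j * fib_height \<theta> j powr s)"
  have lp: "ln (real p) > 0" using prime_gt_1_nat[OF pq(1)] by simp
  have "\<forall>i\<in>{1..n-1}. \<exists>xs\<in>factorizations \<alpha>.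
      \<forall>s. (\<Sum>x\<leftarrow>xs. log_mahler x powr s) = ln (real p) powr s * G (z i) s"
    unfolding \<alpha>_def G_def using Fplus_factorization[OF pq n \<theta> z int] by blast
  then obtain X where X: "\<And>i. i \<in> {1..n-1} \<Longrightarrow> X i \<in> factorizations \<alpha>"
    "\<And>i s. i \<in> {1..n-1} \<Longrightarrow> (\<Sum>x\<leftarrow>X i. log_mahler x powr s) = ln (real p) powr s * G (z i) s"
    by metis
  have ev: "eventually (\<lambda>s. metric_mahler s \<alpha> = tuple_measure s (X i)) (nhds (t i))"
    if i: "i \<in> {1..n-1}" for i
  proof -
    have "eventually (\<lambda>s. s > 0) (nhds (t i))" using t0[OF i] by (rule eventually_nhds_gt)
    with min[OF i] show ?thesis
    proof eventually_elim
      case (elim s)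
      show ?case
      proof (rule metric_mahler_eqI[OF X(1)[OF i] elim(2)])
        fix ys assume ys: "ys \<in> factorizations \<alpha>"
        have "G (z i) s \<le> (\<Sum>j=1..n. y j * fib_height \<theta> j powr s)" if "y \<in> Fplus n" for y
          using elim(1) that unfolding G_def by (cases "y = z i") (auto intro: less_imp_le)
        then show "(\<Sum>x\<leftarrow>X i. log_mahler x powr s) \<le> (\<Sum>x\<leftarrow>ys. log_mahler x powr s)"
          unfolding X(2)[OF i] using ys unfolding \<alpha>_def
          by (intro factorization_lower_bound[OF pq n \<theta> good elim(2)]) auto
      qed
    qed
  qed
  have "\<exists>s. t (i + 1) < s \<and> s < t i \<and> exceptional_point \<alpha> s" if i: "i \<in> {1..n-2}" for i
  proof -
    have i': "i \<in> {1..n-1}" "i + 1 \<in> {1..n-1}" using i n by auto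
    \<comment> \<open>Strictness at \<open>t i\<close> separates the tuple that is optimal near
      \<open>t (i + 1)\<close> from the one optimal near \<open>t i\<close>.\<close>
    have "G (z i) (t i) < G (z (i + 1)) (t i)"
      using eventually_nhds_x_imp_x[OF min[OF i'(1)]] z[OF i'(2)] neq[OF i] unfolding G_def by auto
    then have "\<not> (\<Sum>x\<leftarrow>X (i + 1). log_mahler x powr t i) \<le> (\<Sum>x\<leftarrow>X i. log_mahler x powr t i)"
      unfolding X(2)[OF i'(1)] X(2)[OF i'(2)] using lp by simp
    then have "\<not> tuple_measure (t i) (X (i + 1)) \<le> tuple_measure (t i) (X i)"
      using t0[OF i'(1)] by (simp add: tuple_measure_le_iff)
    then have "tuple_measure (t i) (X (i + 1)) \<noteq> tuple_measure (t i) (X i)" by auto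
    then show ?thesis
      using exceptional_point_between[OF t0[OF i'(2)] dec[OF i] ev[OF i'(2)] X(1)[OF i'(2)] ev[OF i'(1)] X(1)[OF i'(1)]]
      by blast
  qed
  then obtain \<sigma> where \<sigma>: "\<And>i. i \<in> {1..n-2} \<Longrightarrow> t (i + 1) < \<sigma> i"
      "\<And>i. i \<in> {1..n-2} \<Longrightarrow> \<sigma> i < t i" "\<And>i. i \<in> {1..n-2} \<Longrightarrow> exceptional_point \<alpha> (\<sigma> i)"
    by metis
  \<comment> \<open>The exceptional points found lie in the disjoint intervals from
    \<open>t (i + 1)\<close> to \<open>t i\<close>, so there are \<open>n - 2\<close> of
    them.\<close>
  have mono: "t j \<le> t i" if "i \<le> j" "1 \<le> i" "j \<le> n - 1" for i j
    using that
  proof (induction j rule: dec_induct)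
    case (step j)
    then have "t (j + 1) < t j" by (intro dec) auto
    then show ?case using step by simp
  qed simp
  have less: "\<sigma> j < \<sigma> i" if "i < j" "i \<in> {1..n-2}" "j \<in> {1..n-2}" for i j
  proof -
    have "\<sigma> j < t j" using \<sigma>(2) that by simp
    also have "\<dots> \<le> t (i + 1)" using that n by (intro mono) auto
    also have "\<dots> < \<sigma> i" using \<sigma>(1) that by simp
    finally show ?thesis .
  qed
  have "inj_on \<sigma> {1..n-2}"
  proof (rule inj_onI)
    fix i j assume "i \<in> {1..n-2}" "j \<in> {1..n-2}" "\<sigma> i = \<sigma> j"
    then show "i = j" using less[of i j] less[of j i] by (cases i j rule: linorder_cases) auto
  qed
  then have "card (\<sigma> ` {1..n-2}) = n - 2" by (simp add: card_image)
  then show ?thesis using \<sigma>(3) by (intro exI[of _ "\<sigma> ` {1..n-2}"]) (auto simp: \<alpha>_def)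
qed

theorem theorem1p4:
  fixes n :: nat and t :: "nat \<Rightarrow> real" and z :: "nat \<Rightarrow> nat \<Rightarrow> real"
  assumes "n \<ge> 3"
    and "\<forall>i\<in>{1..n-1}. t i > 0"
    and "\<forall>i\<in>{1..n-2}. t i > t (i + 1)"
    and A: "\<forall>i\<in>{1..n-1}.
          (z i \<in> Fplus n \<and> Gfun n (z i) (t i) = Min ((\<lambda>x. Gfun n x (t i)) ` Fplus n)) \<and>
          (\<forall>x\<in>Fplus n. Gfun n x (t i) = Min ((\<lambda>x. Gfun n x (t i)) ` Fplus n) \<longrightarrow> x = z i)"
    and B: "\<forall>i\<in>{1..n-1}. \<forall>j\<in>{1..n}. z i j \<in> \<int>"
    and C: "\<forall>i\<in>{1..n-2}. z i \<noteq> z (i + 1)"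
  shows "infinite {(p :: nat, q :: nat). prime p \<and> prime q \<and>
           (\<exists>T. T \<subseteq> {s. exceptional_point (of_nat p ^ fib n / of_nat q ^ fib (n - 1)) s} \<and>
              finite T \<and> card T \<ge> n - 2)}"
proof -
  define M where "M = (\<lambda>i \<theta>. eventually (\<lambda>s. \<forall>y\<in>Fplus n. y \<noteq> z i \<longrightarrow>
    (\<Sum>j=1..n. z i j * fib_height \<theta> j powr s) < (\<Sum>j=1..n. y j * fib_height \<theta> j powr s)) (nhds (t i)))"
  have "eventually (M i) (nhds golden_ratio)" if i: "i \<in> {1..n-1}" for i
    unfolding M_def
  proof (rule eventually_unique_minimum)
    fix y assume y: "y \<in> Fplus n" "y \<noteq> z i"
    have "Gfun n (z i) (t i) \<le> Gfun n y (t i)"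
      using A i y finite_Fplus by simp
    moreover have "Gfun n y (t i) \<noteq> Gfun n (z i) (t i)" using A i y by metis
    ultimately show "Gfun n (z i) (t i) < Gfun n y (t i)" by simp
  qed
  \<comment> \<open>A single \<theta> must serve all \<open>i\<close> at once, since all the
    exceptional points belong to one quotient.\<close>
  then have "eventually (\<lambda>\<theta>. \<forall>i\<in>{1..n-1}. M i \<theta>) (nhds golden_ratio)"
    by (intro eventually_ball_finite) auto
  then have "eventually (\<lambda>\<theta>. good_ratio n \<theta> \<and> (\<forall>i\<in>{1..n-1}. M i \<theta>)) (nhds golden_ratio)"
    using eventually_good_ratio by (intro eventually_conj) auto
  then obtain \<delta> where \<delta>: "\<delta> > 0"
    "\<And>\<theta>. dist \<theta> golden_ratio < \<delta> \<Longrightarrow> good_ratio n \<theta> \<and> (\<forall>i\<in>{1..n-1}. M i \<theta>)"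
    unfolding eventually_nhds_metric by blast
  have "infinite {(p :: nat, q :: nat). prime p \<and> prime q \<and> p < q \<and> \<bar>ln (real q) / ln (real p) - golden_ratio\<bar> < \<delta>}"
    using golden_ratio_gt_1 \<delta>(1) by (intro infinite_prime_pairs_log_ratio) auto
  then show ?thesis
  proof (rule infinite_super[rotated], safe)
    fix p q :: nat assume pq: "prime p" "prime q" "p < q" "\<bar>ln (real q) / ln (real p) - golden_ratio\<bar> < \<delta>"
    have "good_ratio n (ln (real q) / ln (real p))"
      and M: "\<forall>i\<in>{1..n-1}. M i (ln (real q) / ln (real p))"
      using \<delta>(2) pq(4) by (auto simp: dist_real_def)
    then show "\<exists>T. T \<subseteq> {s. exceptional_point (of_nat p ^ fib n / of_nat q ^ fib (n - 1)) s} \<and>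
              finite T \<and> card T \<ge> n - 2"
      by (intro exceptional_points_of_quotient[OF pq(1-3) \<open>n \<ge> 3\<close> refl, where t = t and z = z])
         (use assms in \<open>auto simp: M_def\<close>)
  qed
qed

end
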